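(* Let $\mathbf{x}$ be a recurrent infinite binary word having property $\mathrm{TM}(k)$ for some $k\ge 1$. Then there exists an infinite binary word $\mathbf{y}$ such that $\mathbf{x}=u\varphi^k(\mathbf{y})$, where $u$ is a proper (possibly empty) suffix of $\varphi^k(0)$ or of $\varphi^k(1)$.
   Context: $\varphi$ is the Thue--Morse morphism $0\mapsto01$, $1\mapsto10$ and $\mathbf{t}$ its fixed point starting with $0$. For words $u,w$, $\binom{u}{w}$ is the number of occurrences of $w$ as a scattered subword of $u$; $u\sim_j v$ if $\binom{u}{x}=\binom{v}{x}$ for all words $x$ of length at most $j$. The $j$-binomial complexity $b^{(j)}_{\mathbf{x}}(n)$ of an infinite word $\mathbf{x}$ is the number of $\sim_j$-classes among its length-$n$ factors. A binary word $\mathbf{x}$ has property $\mathrm{TM}(k)$ if $b^{(j)}_{\mathbf{x}}=b^{(j)}_{\mathbf{t}}$ for all $1\le j\le k$. A word is recurrent if each of its factors occurs infinitely often in it. *)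

theory Defs
  imports "HOL-Library.Stream" "HOL-Library.Sublist"
begin

text \<open>Binary words are over \<^typ>\<open>bool\<close>: the letter 0 is \<^term>\<open>False\<close>, the letter 1 is \<^term>\<open>True\<close>.\<close>

definition morph :: "('a \<Rightarrow> 'b list) \<Rightarrow> 'a list \<Rightarrow> 'b list" where
  "morph h w = concat (map h w)"

text \<open>Meaningful for non-erasing morphisms, i.e. if no \<^term>\<open>h a\<close> is empty.\<close>

definition smorph :: "('a \<Rightarrow> 'b list) \<Rightarrow> 'a stream \<Rightarrow> 'b stream" where
  "smorph h s = flat (smap h s)"

definition tm_letter :: "bool \<Rightarrow> bool list" where
  "tm_letter a = [a, \<not> a]"

definition tm_morph :: "bool list \<Rightarrow> bool list" where
  "tm_morph = morph tm_letter"

definition tm_smorph :: "bool stream \<Rightarrow> bool stream" where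
  "tm_smorph = smorph tm_letter"

definition thue_morse :: "bool stream" where
  "thue_morse = (THE s. tm_smorph s = s \<and> shd s = False)"

text \<open>Occurrences are counted by position sets, so equal words at different positions count separately.\<close>

definition subword_count :: "'a list \<Rightarrow> 'a list \<Rightarrow> nat" where
  "subword_count u w = card {I. I \<subseteq> {..<length u} \<and> nths u I = w}"

definition binom_equiv :: "nat \<Rightarrow> 'a list \<Rightarrow> 'a list \<Rightarrow> bool" where
  "binom_equiv j u v \<longleftrightarrow> (\<forall>x. length x \<le> j \<longrightarrow> subword_count u x = subword_count v x)"

definition occurs_at :: "'a list \<Rightarrow> 'a stream \<Rightarrow> nat \<Rightarrow> bool" where
  "occurs_at w s i \<longleftrightarrow> stake (length w) (sdrop i s) = w"

definition factors :: "'a stream \<Rightarrow> 'a list set" where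
  "factors s = {w. \<exists>i. occurs_at w s i}"

definition binom_complexity :: "nat \<Rightarrow> 'a::finite stream \<Rightarrow> nat \<Rightarrow> nat" where
  "binom_complexity j s n =
     card ({w \<in> factors s. length w = n} // {(u, v). binom_equiv j u v})"

definition TM :: "nat \<Rightarrow> bool stream \<Rightarrow> bool" where
  "TM k s \<longleftrightarrow> (\<forall>j\<in>{1..k}. binom_complexity j s = binom_complexity j thue_morse)"

definition recurrent :: "'a stream \<Rightarrow> bool" where
  "recurrent s \<longleftrightarrow> (\<forall>w\<in>factors s. infinite {i. occurs_at w s i})"

lemma stream_snth_eq: "s = t \<longleftrightarrow> (\<forall>n. s !! n = t !! n)"
  by (metis ext stream_smap_nats)

lemma tm_smorph_SCons: "tm_smorph (a ## s) = a ## (\<not> a) ## tm_smorph s"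
  by (simp add: tm_smorph_def smorph_def tm_letter_def)

lemma snth_tm_smorph: "tm_smorph s !! n = (s !! (n div 2) \<noteq> odd n)"
proof (induction n arbitrary: s rule: less_induct)
  case (less n)
  obtain a r where s: "s = a ## r" by (cases s)
  consider "n = 0" | "n = 1" | m where "n = Suc (Suc m)"
    by (cases n; cases "n - 1") auto
  then show ?case
  proof cases
    case 3
    then show ?thesis using less[of m r] by (simp add: s tm_smorph_SCons)
  qed (auto simp: s tm_smorph_SCons)
qed

fun tm_nth :: "nat \<Rightarrow> bool" where
  "tm_nth n = (if n = 0 then False else tm_nth (n div 2) \<noteq> odd n)"

declare tm_nth.simps [simp del]

lemma thue_morse_ex1: "\<exists>!s. tm_smorph s = s \<and> shd s = False"
proof (rule ex1I)
  show "tm_smorph (smap tm_nth nats) = smap tm_nth nats \<and> shd (smap tm_nth nats) = False"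
  proof
    show "tm_smorph (smap tm_nth nats) = smap tm_nth nats"
    proof (subst stream_snth_eq, intro allI)
      fix n show "tm_smorph (smap tm_nth nats) !! n = smap tm_nth nats !! n"
        unfolding snth_tm_smorph
        by (cases "n = 0") (simp_all add: tm_nth.simps[of n] tm_nth.simps[of 0])
    qed
  qed (simp add: tm_nth.simps)
next
  fix s assume s: "tm_smorph s = s \<and> shd s = False"
  have "s !! n = tm_nth n" for n
  proof (induction n rule: less_induct)
    case (less n)
    show ?case
    proof (cases "n = 0")
      case True
      then show ?thesis using s by (simp add: tm_nth.simps)
    next
      case False
      then have "s !! n = (s !! (n div 2) \<noteq> odd n)"
        using s snth_tm_smorph by metis
      then show ?thesis using less[of "n div 2"] False by (simp add: tm_nth.simps[of n])
    qed
  qed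
  then show "s = smap tm_nth nats" by (auto simp: stream_snth_eq)
qed

lemma thue_morse_fixpoint: "tm_smorph thue_morse = thue_morse" "shd thue_morse = False"
  using theI'[OF thue_morse_ex1] unfolding thue_morse_def by auto

end

theory Submission
  imports Defs "HOL-Computational_Algebra.Polynomial"
begin

text \<open>
  Encode a binary word by the polynomial \<open>\<Sum> \<plusminus> (1 + Y)\<^sup>p\<close> over its positions p, the sign being given by the letter
  at p. Binomial equivalence of order j implies congruence of these polynomials modulo \<open>Y\<^sup>j\<close>; the morphism
  turns a polynomial f into \<open>- Y f(2 Y + Y\<^sup>2)\<close>, so it shifts the congruence by exactly one order. On factors of
  a k-fold image both relations of order k + 1 therefore coincide, and comparing constant and linear
  coefficients shows that the offset and the boundary letters of a factor are determined by its class,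
  except that an alternating word can be read at two offsets. Hence the number of classes of order k + 1 of length
  \<open>2\<^sup>k m\<close> of the k-fold image of y is \<open>N + (2\<^sup>k - 1) T\<close>, where N counts the balances of the factors w of
  length m of y, and T the triples of a first letter, the balance of w and a last letter over the factors awb of
  length m + 1. For the Thue--Morse word T = 6, and N is 3 or 2 according to the parity of m.

  If y is recurrent, the balance of a window sliding along y moves up and down between any two
  consecutive values, so \<open>T \<ge> 2 (N - 1)\<close>. For k at least 2 this forces y to have the abelian complexity of the
  Thue--Morse word; for k = 1 factors of odd length of the image are used in addition. Then factors of y of
  odd length have balance 1 or -1, so the walk with steps 1 and -1 along y is constant on the positions
  of one parity, which means that y is an image under the morphism up to its first letter. A pigeonhole
  argument on the offsets at which the prefixes of x reappear far out in x extends the desubstitution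
  of a tail to all of x.
\<close>

subsection \<open>Counting scattered subwords\<close>

text \<open>Integer values, because differences of counts are formed and summed below.\<close>

definition icount :: "'a list \<Rightarrow> 'a list \<Rightarrow> int" where
  "icount u w = int (subword_count u w)"

lemma icount_Nil_right [simp]: "icount u [] = 1"
proof -
  have "I = {}" if "I \<subseteq> {..<length u}" "nths u I = []" for I
  proof -
    have "card {i. i < length u \<and> i \<in> I} = 0"
      using that(2) length_nths[of u I] by simp
    moreover have "{i. i < length u \<and> i \<in> I} = I" using that(1) by auto
    moreover have "finite I" using that(1) finite_subset by blast
    ultimately show ?thesis by simp
  qed
  then have "{I. I \<subseteq> {..<length u} \<and> nths u I = []} = {{}}" by auto
  then show ?thesis by (simp add: icount_def subword_count_def)
qed

lemma icount_Nil_Cons [simp]: "icount [] (b # x) = 0"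
  by (simp add: icount_def subword_count_def)

text \<open>A position set either avoids position 0, and is then a shifted set for \<open>u\<close>,
  or contains it and matches the first letter with \<open>b\<close>.\<close>

lemma icount_Cons_Cons [simp]:
  "icount (a # u) (b # x) = icount u (b # x) + (if a = b then icount u x else 0)"
proof -
  define W where "W y = {I. I \<subseteq> {..<length u} \<and> nths u I = y}" for y
  have fin: "finite (W y)" for y
    unfolding W_def by (rule finite_subset[of _ "Pow {..<length u}"]) auto
  define W' where "W' = {I. I \<subseteq> {..<length (a # u)} \<and> nths (a # u) I = b # x}"
  have nths: "nths (a # u) I = (if 0 \<in> I then [a] else []) @ nths u {j. Suc j \<in> I}" for I
    by (simp add: nths_Cons)
  have sub: "I \<subseteq> {..<length (a # u)} \<longleftrightarrow> {j. Suc j \<in> I} \<subseteq> {..<length u}" for I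
    by (auto simp: subset_iff lessThan_iff) (metis Suc_less_eq zero_less_Suc not0_implies_Suc)
  have im0: "{I \<in> W'. 0 \<notin> I} = (`) Suc ` W (b # x)"
  proof (intro equalityI subsetI)
    fix I assume I: "I \<in> {I \<in> W'. 0 \<notin> I}"
    have "I = Suc ` {j. Suc j \<in> I}"
      using I by (auto simp: image_iff) (metis not0_implies_Suc)
    moreover have "{j. Suc j \<in> I} \<in> W (b # x)"
      using I by (auto simp: W'_def W_def nths)
    ultimately show "I \<in> (`) Suc ` W (b # x)" by blast
  next
    fix I assume "I \<in> (`) Suc ` W (b # x)"
    then obtain J where J: "I = Suc ` J" "J \<in> W (b # x)" by blast
    have "{j. Suc j \<in> I} = J" "0 \<notin> I" using J by auto
    then show "I \<in> {I \<in> W'. 0 \<notin> I}"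
      using J unfolding W'_def W_def mem_Collect_eq sub nths by simp
  qed
  have im1: "{I \<in> W'. 0 \<in> I} = (if a = b then (\<lambda>J. insert 0 (Suc ` J)) ` W x else {})"
  proof (cases "a = b")
    case True
    have "{I \<in> W'. 0 \<in> I} = (\<lambda>J. insert 0 (Suc ` J)) ` W x"
    proof (intro equalityI subsetI)
      fix I assume I: "I \<in> {I \<in> W'. 0 \<in> I}"
      have "I = insert 0 (Suc ` {j. Suc j \<in> I})"
        using I by (auto simp: image_iff) (metis not0_implies_Suc)
      moreover have "{j. Suc j \<in> I} \<in> W x"
        using I by (auto simp: W'_def W_def nths)
      ultimately show "I \<in> (\<lambda>J. insert 0 (Suc ` J)) ` W x" by blast
    next
      fix I assume "I \<in> (\<lambda>J. insert 0 (Suc ` J)) ` W x"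
      then obtain J where J: "I = insert 0 (Suc ` J)" "J \<in> W x" by blast
      have "{j. Suc j \<in> I} = J" "0 \<in> I" using J by auto
      then show "I \<in> {I \<in> W'. 0 \<in> I}"
        using J True unfolding W'_def W_def mem_Collect_eq sub nths by simp
    qed
    then show ?thesis using True by simp
  next
    case False
    then show ?thesis by (auto simp: W'_def nths)
  qed
  have inj0: "inj_on ((`) Suc) A" for A
    by (simp add: inj_on_def inj_image_eq_iff)
  have inj1: "inj_on (\<lambda>J. insert 0 (Suc ` J)) A" for A
  proof (rule inj_onI)
    fix I J :: "nat set" assume "insert 0 (Suc ` I) = insert 0 (Suc ` J)"
    moreover have "0 \<notin> Suc ` I" "0 \<notin> Suc ` J" by auto
    ultimately have "Suc ` I = Suc ` J" by (rule insert_ident[THEN iffD1, rotated 2])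
    then show "I = J" by (simp add: inj_image_eq_iff)
  qed
  have "W' = {I \<in> W'. 0 \<notin> I} \<union> {I \<in> W'. 0 \<in> I}" by blast
  moreover have "finite W'"
    unfolding W'_def by (rule finite_subset[of _ "Pow {..<length (a # u)}"]) auto
  ultimately have "card W' = card {I \<in> W'. 0 \<notin> I} + card {I \<in> W'. 0 \<in> I}"
    by (metis (no_types, lifting) card_Un_disjoint disjoint_iff finite_Un mem_Collect_eq)
  also have "card {I \<in> W'. 0 \<notin> I} = card (W (b # x))"
    unfolding im0 by (rule card_image[OF inj0])
  also have "card {I \<in> W'. 0 \<in> I} = (if a = b then card (W x) else 0)"
    unfolding im1 by (simp add: card_image[OF inj1])
  finally show ?thesis
    by (simp add: icount_def subword_count_def W_def W'_def)
qed

lemma binom_equiv_iff_icount: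
  "binom_equiv j u v \<longleftrightarrow> (\<forall>x. length x \<le> j \<longrightarrow> icount u x = icount v x)"
  by (simp add: binom_equiv_def icount_def)

lemma icount_snoc_snoc:
  "icount (u @ [a]) (x @ [b]) = icount u (x @ [b]) + (if a = b then icount u x else 0)"
proof (induction u arbitrary: x)
  case Nil
  show ?case by (cases x; cases "tl x") auto
next
  case (Cons c u)
  show ?case
  proof (cases x)
    case Nil
    then show ?thesis using Cons.IH[of "[]"] by auto
  next
    case (Cons d x')
    show ?thesis using Cons.IH[of x] Cons.IH[of x'] by (auto simp: Cons)
  qed
qed

lemma binom_equiv_Cons:
  fixes u v :: "'a list"
  shows "binom_equiv j u v \<Longrightarrow> binom_equiv j (a # u) (a # v)"
  unfolding binom_equiv_iff_icount
proof (intro allI impI)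
  fix x :: "'a list" assume *: "\<forall>x. length x \<le> j \<longrightarrow> icount u x = icount v x" "length x \<le> j"
  then show "icount (a # u) x = icount (a # v) x" by (cases x) auto
qed

lemma binom_equiv_snoc:
  fixes u v :: "'a list"
  shows "binom_equiv j u v \<Longrightarrow> binom_equiv j (u @ [a]) (v @ [a])"
  unfolding binom_equiv_iff_icount
proof (intro allI impI)
  fix x :: "'a list" assume *: "\<forall>x. length x \<le> j \<longrightarrow> icount u x = icount v x" "length x \<le> j"
  then show "icount (u @ [a]) x = icount (v @ [a]) x"
    by (cases x rule: rev_cases) (auto simp: icount_snoc_snoc)
qed

section \<open>Sums over words and subword counts in an image\<close>

primrec sum_words :: "nat \<Rightarrow> (bool list \<Rightarrow> int) \<Rightarrow> int" where
  "sum_words 0 f = f []"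
| "sum_words (Suc r) f = sum_words r (\<lambda>e. f (False # e)) + sum_words r (\<lambda>e. f (True # e))"

lemma sum_words_add: "sum_words r (\<lambda>e. f e + g e) = sum_words r f + sum_words r g"
  by (induction r arbitrary: f g) auto

lemma sum_words_diff: "sum_words r (\<lambda>e. f e - g e) = sum_words r f - sum_words r g"
  by (induction r arbitrary: f g) auto

lemma sum_words_zero [simp]: "sum_words r (\<lambda>e. 0) = 0"
  by (induction r) auto

lemma sum_words_cong: "(\<And>e. length e = r \<Longrightarrow> f e = g e) \<Longrightarrow> sum_words r f = sum_words r g"
proof (induction r arbitrary: f g)
  case (Suc r)
  show ?case using Suc.IH[of "\<lambda>e. f (False # e)" "\<lambda>e. g (False # e)"]
     Suc.IH[of "\<lambda>e. f (True # e)" "\<lambda>e. g (True # e)"] Suc.prems by simp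
qed simp

text \<open>Each set of \<open>r\<close> positions of \<open>u\<close> spells exactly one word of
  length \<open>r\<close>, so summing over all such words counts the sets.\<close>

lemma sum_words_icount: "sum_words r (icount u) = int (length u choose r)"
proof (induction u arbitrary: r)
  case Nil
  show ?case by (cases r) auto
next
  case (Cons a u)
  show ?case
  proof (cases r)
    case (Suc r')
    have "sum_words r (icount (a # u)) = sum_words r (icount u) + sum_words r' (icount u)"
      by (cases a) (simp_all add: Suc sum_words_add)
    then show ?thesis by (simp add: Cons.IH Suc)
  qed simp
qed

lemma tm_morph_Nil [simp]: "tm_morph [] = []"
  by (simp add: tm_morph_def morph_def)

lemma tm_morph_Cons [simp]: "tm_morph (a # u) = a # (\<not> a) # tm_morph u"
  by (simp add: tm_morph_def morph_def tm_letter_def)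

lemma tm_morph_append [simp]: "tm_morph (u @ v) = tm_morph u @ tm_morph v"
  by (simp add: tm_morph_def morph_def)

lemma length_tm_morph [simp]: "length (tm_morph u) = 2 * length u"
  by (induction u) auto

text \<open>An occurrence of x in the image of u uses one or both letters of the image of each letter of u
  it meets. A letter of u that contributes a single letter is arbitrary, since both images contain
  each letter exactly once; one that contributes two is determined.\<close>

fun sum_preimages :: "bool list \<Rightarrow> (bool list \<Rightarrow> int) \<Rightarrow> int" where
  "sum_preimages [] f = f []"
| "sum_preimages [b] f = f [False] + f [True]"
| "sum_preimages (b # c # x) f =
     sum_preimages (c # x) (\<lambda>e. f (False # e)) + sum_preimages (c # x) (\<lambda>e. f (True # e))
     + (if b \<noteq> c then sum_preimages x (\<lambda>e. f (b # e)) else 0)"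

lemma sum_preimages_add:
  "sum_preimages x (\<lambda>e. f e + g e) = sum_preimages x f + sum_preimages x g"
  by (induction x f arbitrary: g rule: sum_preimages.induct) simp_all

lemma sum_preimages_diff:
  "sum_preimages x (\<lambda>e. f e - g e) = sum_preimages x f - sum_preimages x g"
  by (induction x f arbitrary: g rule: sum_preimages.induct) simp_all

lemma sum_preimages_zero: "(\<And>e. length e \<le> length x \<Longrightarrow> f e = 0) \<Longrightarrow> sum_preimages x f = 0"
  by (induction x f rule: sum_preimages.induct) auto

text \<open>Terms in which one seed letter supplies two letters of \<open>x\<close> use shorter
  words and vanish; the remaining ones run over all words of full length.\<close>

lemma sum_preimages_top:
  "(\<And>e. length e < length x \<Longrightarrow> f e = 0) \<Longrightarrow> sum_preimages x f = sum_words (length x) f"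
proof (induction x f rule: sum_preimages.induct)
  case (3 b c x f)
  have "sum_preimages x (\<lambda>e. f (d # e)) = 0" for d
    by (rule sum_preimages_zero) (use "3.prems" in auto)
  then show ?case using "3.IH"(1,2) "3.prems" by simp
qed auto

lemma icount_tm_morph: "icount (tm_morph u) x = sum_preimages x (icount u)"
proof (induction u arbitrary: x)
  case Nil
  have "sum_preimages x f = 0" if "x \<noteq> []" "\<And>a e. f (a # e) = 0" for f
    using that sum_preimages_zero by (induction x f rule: sum_preimages.induct) auto
  then show ?case by (cases x) auto
next
  case (Cons a u)
  consider "x = []" | b where "x = [b]" | b c y where "x = b # c # y"
    by (metis list.exhaust)
  then show ?case
  proof cases
    case (3 b c y)
    have "sum_preimages x (icount (a # u)) = sum_preimages x (icount u) + sum_preimages (c # y) (icount u)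
        + (if b \<noteq> c \<and> a = b then sum_preimages y (icount u) else 0)"
      by (cases a) (simp_all add: 3 sum_preimages_add sum_preimages_zero)
    then show ?thesis unfolding Cons.IH[symmetric] by (auto simp: 3)
  qed (use Cons.IH in auto)
qed

text \<open>The morphism gains one order: differences on shorter words vanish, and the sum over all
  words of top length is a binomial coefficient in the common length.\<close>

lemma binom_equiv_tm_morph:
  assumes "binom_equiv j u v" "length u = length v"
  shows "binom_equiv (Suc j) (tm_morph u) (tm_morph v)"
  unfolding binom_equiv_iff_icount
proof (intro allI impI)
  fix x :: "bool list" assume x: "length x \<le> Suc j"
  have "icount (tm_morph u) x - icount (tm_morph v) x = sum_preimages x (\<lambda>e. icount u e - icount v e)"
    by (simp add: icount_tm_morph sum_preimages_diff)
  also have "\<dots> = sum_words (length x) (\<lambda>e. icount u e - icount v e)"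
    by (rule sum_preimages_top) (use assms x in \<open>auto simp: binom_equiv_iff_icount\<close>)
  also have "\<dots> = 0" by (simp add: sum_words_diff sum_words_icount assms)
  finally show "icount (tm_morph u) x = icount (tm_morph v) x" by simp
qed

subsection \<open>Moments of binary words\<close>

definition sgnb :: "bool \<Rightarrow> int" where
  "sgnb a = (if a then 1 else - 1)"

lemma sgnb_simps [simp]: "sgnb True = 1" "sgnb False = - 1" "sgnb (\<not> a) = - sgnb a"
  by (auto simp: sgnb_def)

lemma sgnb_inject [simp]: "sgnb a = sgnb b \<longleftrightarrow> a = b"
  by (auto simp: sgnb_def)

text \<open>The coefficient of degree i is the sum of \<open>\<plusminus> (p choose i)\<close> over all positions p, the sign being
  given by the letter at p.\<close>

fun word_poly :: "bool list \<Rightarrow> int poly" where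
  "word_poly [] = 0"
| "word_poly (a # u) = [:sgnb a:] + [:1, 1:] * word_poly u"

text \<open>Divisibility is the form that can be followed through multiplication by
  \<open>1 + Y\<close> and through substitution.\<close>

definition moment_equiv :: "nat \<Rightarrow> bool list \<Rightarrow> bool list \<Rightarrow> bool" where
  "moment_equiv j u v \<longleftrightarrow> length u = length v \<and> monom 1 j dvd word_poly u - word_poly v"

lemma moment_equiv_iff_coeff:
  "moment_equiv j u v \<longleftrightarrow>
     length u = length v \<and> (\<forall>i<j. coeff (word_poly u) i = coeff (word_poly v) i)"
  by (auto simp: moment_equiv_def monom_1_dvd_iff')

lemma moment_equiv_mono: "moment_equiv j u v \<Longrightarrow> i \<le> j \<Longrightarrow> moment_equiv i u v"
  by (auto simp: moment_equiv_iff_coeff)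

text \<open>The number \<open>p choose i\<close> counts the choices of \<open>i\<close> positions
  before \<open>p\<close>, so the coefficient counts subwords of length \<open>i + 1\<close>, signed
  by their last letter.\<close>

lemma coeff_word_poly_eq_sum_words:
  "coeff (word_poly u) i = sum_words i (\<lambda>e. icount u (e @ [True]) - icount u (e @ [False]))"
proof (induction u arbitrary: i)
  case Nil
  have "sum_words i (\<lambda>e. icount [] (e @ [True]) - icount [] (e @ [False])) = sum_words i (\<lambda>e. 0)"
    by (rule sum_words_cong) (case_tac e; simp)
  then show ?case by simp
next
  case (Cons a u)
  show ?case
  proof (cases i)
    case 0
    then show ?thesis using Cons.IH[of 0] by (cases a) auto
  next
    case (Suc i')
    have "sum_words i (\<lambda>e. icount (a # u) (e @ [True]) - icount (a # u) (e @ [False]))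
      = sum_words i (\<lambda>e. icount u (e @ [True]) - icount u (e @ [False]))
      + sum_words i' (\<lambda>e. icount u (e @ [True]) - icount u (e @ [False]))"
      by (cases a) (simp_all add: Suc sum_words_add sum_words_diff)
    then show ?thesis using Cons.IH[of i] Cons.IH[of i'] by (simp add: Suc coeff_pCons)
  qed
qed

lemma binom_equiv_length:
  assumes "binom_equiv j u v" "j \<ge> 1"
  shows "length u = length (v :: bool list)"
proof -
  have "sum_words 1 (icount u) = sum_words 1 (icount v)"
    by (rule sum_words_cong) (use assms in \<open>simp add: binom_equiv_iff_icount\<close>)
  then show ?thesis unfolding sum_words_icount by simp
qed

lemma binom_equiv_imp_moment_equiv:
  assumes "binom_equiv j u v" "j \<ge> 1"
  shows "moment_equiv j u v"
  unfolding moment_equiv_iff_coeff coeff_word_poly_eq_sum_words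
  using assms binom_equiv_length[OF assms]
  by (auto intro!: sum_words_cong simp: binom_equiv_iff_icount)

text \<open>The length is the sum of the two letter counts and the constant coefficient is their
  difference.\<close>

lemma moment_equiv_one_imp_binom_equiv:
  assumes "moment_equiv 1 u v"
  shows "binom_equiv 1 u v"
proof -
  have "icount u [False] + icount u [True] = icount v [False] + icount v [True]"
    using sum_words_icount[of 1 u] sum_words_icount[of 1 v] assms
    by (simp add: moment_equiv_def)
  moreover have "icount u [True] - icount u [False] = icount v [True] - icount v [False]"
    using assms coeff_word_poly_eq_sum_words[of _ 0] by (simp add: moment_equiv_iff_coeff)
  ultimately have "icount u [a] = icount v [a]" for a by (cases a) auto
  then show ?thesis unfolding binom_equiv_iff_icount
    by (auto simp: le_Suc_eq length_Suc_conv)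
qed

lemma word_poly_snoc: "word_poly (u @ [a]) = word_poly u + smult (sgnb a) ([:1, 1:] ^ length u)"
  by (induction u) (auto simp: algebra_simps)

text \<open>The polynomial \<open>1 + Y\<close> does not vanish at 0, so multiplying by it keeps the
  order of vanishing there.\<close>

lemma monom_1_dvd_one_plus_X_times:
  "monom 1 j dvd [:1, 1:] * p \<longleftrightarrow> monom 1 j dvd (p :: int poly)"
proof (cases "p = 0")
  case False
  have "order 0 ([:1, 1:] :: int poly) = 0" by (rule order_0I) simp
  moreover have "[:1, 1:] * p \<noteq> 0" by (rule no_zero_divisors) (use False in auto)
  ultimately have "order 0 ([:1, 1:] * p) = order 0 p" by (metis order_mult add_0)
  then show ?thesis using False \<open>[:1, 1:] * p \<noteq> 0\<close> by (metis monom_1_dvd_iff)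
qed simp

lemma moment_equiv_Cons [simp]: "moment_equiv j (a # u) (a # v) \<longleftrightarrow> moment_equiv j u v"
proof -
  have "word_poly (a # u) - word_poly (a # v) = [:1, 1:] * (word_poly u - word_poly v)"
    by (simp add: algebra_simps)
  then show ?thesis unfolding moment_equiv_def by (simp only: monom_1_dvd_one_plus_X_times) simp
qed

lemma moment_equiv_snoc [simp]: "moment_equiv j (u @ [a]) (v @ [a]) \<longleftrightarrow> moment_equiv j u v"
  by (auto simp: moment_equiv_def word_poly_snoc)

text \<open>A letter of sign s at position p contributes s (1 + Y)^(2p) - s (1 + Y)^(2p+1) = - s Y
  (1 + Y)^(2p), and (1 + Y)^2 = 1 + (2 Y + Y^2).\<close>

lemma word_poly_tm_morph: "word_poly (tm_morph u) = - (monom 1 1 * (word_poly u \<circ>\<^sub>p [:0, 2, 1:]))"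
proof (induction u)
  case (Cons a u)
  have "smult 2 p = 2 * p" for p :: "int poly" by (simp add: numeral_poly)
  then show ?case
    by (simp add: Cons.IH pcompose_add pcompose_mult pcompose_pCons monom_Suc algebra_simps)
qed simp

text \<open>The polynomial 2 Y + Y^2 = Y (2 + Y) has a simple zero at 0, so substituting it keeps
  the order of vanishing there.\<close>

lemma monom_1_dvd_pcompose:
  "monom 1 j dvd p \<circ>\<^sub>p [:0, 2, 1:] \<longleftrightarrow> monom 1 j dvd (p :: int poly)"
proof (cases "p = 0")
  case False
  define q :: "int poly" where "q = [:0, 2, 1:]"
  have q: "q = [:0, 1:] * [:2, 1:]" by (simp add: q_def)
  obtain r where r: "p = [:0, 1:] ^ order 0 p * r" "\<not> [:0, 1:] dvd r"
    using order_decomp[OF False, of 0] by auto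
  have r0: "poly r 0 \<noteq> 0" using r(2) poly_eq_0_iff_dvd[of r 0] by simp
  \<comment> \<open>The cofactor left after extracting the power of Y; its value at 0 is a power of
    2 times \<open>poly r 0\<close>.\<close>
  define s where "s = [:2, 1:] ^ order 0 p * (r \<circ>\<^sub>p q)"
  have pow: "[:0, 1:] ^ n \<circ>\<^sub>p q = q ^ n" for n
    by (induction n) (simp_all only: power_Suc power_0 pcompose_mult pcompose_1, simp add: pcompose_pCons)
  have "p \<circ>\<^sub>p q = ([:0, 1:] ^ order 0 p \<circ>\<^sub>p q) * (r \<circ>\<^sub>p q)"
    by (subst r(1)) (rule pcompose_mult)
  also have "[:0, 1:] ^ order 0 p \<circ>\<^sub>p q = q ^ order 0 p"
    by (rule pow)
  finally have pq: "p \<circ>\<^sub>p q = [:0, 1:] ^ order 0 p * s"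
    by (simp only: s_def q power_mult_distrib mult.assoc)
  have s0: "poly s 0 \<noteq> 0" using r0 by (simp add: s_def poly_pcompose q_def)
  then have "s \<noteq> 0" by auto
  then have nz: "[:0, 1:] ^ order 0 p * s \<noteq> 0" by simp
  have "order 0 s = 0" using s0 by (rule order_0I)
  moreover have "order 0 ([:0, 1:] ^ order 0 p :: int poly) = order 0 p"
    using order_power_n_n[of "0::int" "order 0 p"] by simp
  ultimately have "order 0 (p \<circ>\<^sub>p q) = order 0 p"
    using order_mult[OF nz] by (simp add: pq)
  then show ?thesis using False nz by (simp add: monom_1_dvd_iff pq flip: q_def)
qed simp

lemma moment_equiv_tm_morph [simp]:
  "moment_equiv (Suc j) (tm_morph u) (tm_morph v) \<longleftrightarrow> moment_equiv j u v"
proof -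
  have "word_poly (tm_morph u) - word_poly (tm_morph v)
      = - (monom 1 1 * ((word_poly u - word_poly v) \<circ>\<^sub>p [:0, 2, 1:]))"
    by (simp add: word_poly_tm_morph pcompose_diff algebra_simps)
  moreover have "monom 1 (Suc j) dvd - (monom 1 1 * p) \<longleftrightarrow> monom 1 j dvd p" for p :: "int poly"
  proof -
    have "monom 1 (Suc j) = monom 1 1 * (monom 1 j :: int poly)" by (simp add: mult_monom)
    then show ?thesis by (simp add: monom_eq_0_iff)
  qed
  ultimately show ?thesis
    unfolding moment_equiv_def by (simp add: monom_1_dvd_pcompose)
qed

fun balance :: "bool list \<Rightarrow> int" where
  "balance [] = 0"
| "balance (a # u) = sgnb a + balance u"

lemma balance_append [simp]: "balance (u @ v) = balance u + balance v"
  by (induction u) auto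

lemma coeff_0_word_poly: "coeff (word_poly u) 0 = balance u"
  by (induction u) auto

lemma coeff_1_word_poly_snoc:
  "coeff (word_poly (u @ [a])) (Suc 0) = coeff (word_poly u) (Suc 0) + int (length u) * sgnb a"
proof -
  have "coeff ([:1, 1:] ^ n :: int poly) (Suc 0) = int n" for n
    by (induction n) (auto simp: coeff_pCons coeff_0_power)
  then show ?thesis by (simp add: word_poly_snoc)
qed

text \<open>The linear coefficient weights each sign by its position; prepending a letter raises
  every old position by one.\<close>

lemma coeff_1_word_poly_Cons:
  "coeff (word_poly (a # u)) (Suc 0) = coeff (word_poly u) (Suc 0) + balance u"
  by (simp add: coeff_pCons coeff_0_word_poly)

lemma balance_tm_morph [simp]: "balance (tm_morph u) = 0"
  by (induction u) auto

lemma coeff_1_word_poly_tm_morph: "coeff (word_poly (tm_morph u)) (Suc 0) = - balance u"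
  by (induction u) (auto simp: coeff_pCons coeff_0_word_poly)

lemma balance_le: "sgnb c * balance u \<le> int (length u)"
  by (induction u) (auto simp: sgnb_def algebra_simps)

text \<open>This rigidity is what identifies words whose blocks can be read at two offsets.\<close>

lemma balance_extremal: "balance u = sgnb c * int (length u) \<longleftrightarrow> u = replicate (length u) c"
proof
  assume "balance u = sgnb c * int (length u)"
  then show "u = replicate (length u) c"
  proof (induction u)
    case (Cons a u)
    have "sgnb c * balance u \<le> int (length u)" by (rule balance_le)
    then show ?case using Cons by (cases a; cases c) (auto simp: algebra_simps)
  qed simp
next
  have "balance (replicate n c) = sgnb c * int n" for n
    by (induction n) (auto simp: algebra_simps)
  then show "u = replicate (length u) c \<Longrightarrow> balance u = sgnb c * int (length u)" by metis
qed

lemma moment_equiv_2_iff: "moment_equiv 2 u v \<longleftrightarrow> length u = length v \<and> balance u = balance v \<and>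
    coeff (word_poly u) (Suc 0) = coeff (word_poly v) (Suc 0)"
  by (auto simp: moment_equiv_iff_coeff coeff_0_word_poly numeral_2_eq_2 less_Suc_eq)

subsection \<open>Factors of iterated images\<close>

text \<open>Both sides are the alternating word of odd length that starts and ends with
  \<open>c\<close>.\<close>

lemma tm_morph_replicate_snoc:
  "tm_morph (replicate n c) @ [c] = c # tm_morph (replicate n (\<not> c))"
  by (induction n) auto

lemma tm_morph_replicate_Suc:
  "tm_morph (replicate (Suc n) (\<not> b)) = (\<not> b) # tm_morph (replicate n b) @ [b]"
  by (simp add: tm_morph_replicate_snoc)

text \<open>The linear coefficients force the balances of \<open>u\<close> and \<open>v\<close> to
  differ by \<open>length u + length v\<close>, so both are extremal with opposite signs.\<close>

lemma moment_equiv_even_odd_offset: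
  assumes "moment_equiv 2 (tm_morph u) (a # tm_morph v @ [b])"
  shows "a = (\<not> b) \<and> u = replicate (length u) (\<not> b) \<and> v = replicate (length v) b"
proof -
  have len: "length u = Suc (length v)" and ab: "sgnb a = - sgnb b"
    and eq: "- balance u = - balance v + int (2 * length v + 1) * sgnb b"
    using assms coeff_1_word_poly_snoc[of "a # tm_morph v" b]
    unfolding moment_equiv_2_iff
    by (auto simp: coeff_1_word_poly_tm_morph coeff_1_word_poly_Cons simp del: word_poly.simps)
  have a: "a = (\<not> b)" using ab by (auto simp: sgnb_def split: if_splits)
  have "balance u = sgnb (\<not> b) * int (length u)" "balance v = sgnb b * int (length v)"
    using eq len balance_le[of "\<not> b" u] balance_le[of b v] by (cases b; simp)+
  then show ?thesis using a balance_extremal by blast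
qed

text \<open>If the last letters differed, the linear coefficients would require the balances of
  \<open>v\<close> and \<open>v'\<close> to differ by more than twice their common length. The
  constant coefficient then fixes the first letter.\<close>

lemma moment_equiv_odd_offset_ends:
  assumes "moment_equiv 2 (a # tm_morph v @ [b]) (a' # tm_morph v' @ [b'])"
  shows "a = a' \<and> b = b'"
proof -
  have len: "length v = length v'" and ab: "sgnb a + sgnb b = sgnb a' + sgnb b'"
    and eq: "- balance v + int (2 * length v + 1) * sgnb b
           = - balance v' + int (2 * length v' + 1) * sgnb b'"
    using assms coeff_1_word_poly_snoc[of "a # tm_morph v" b]
      coeff_1_word_poly_snoc[of "a' # tm_morph v'" b']
    unfolding moment_equiv_2_iff
    by (auto simp: coeff_1_word_poly_tm_morph coeff_1_word_poly_Cons simp del: word_poly.simps)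
  have "b = b'"
    using eq len balance_le[of True v] balance_le[of False v] balance_le[of True v']
      balance_le[of False v'] by (cases b; cases b'; simp)
  then show ?thesis using ab by simp
qed

text \<open>Again the balances must differ by the largest possible amount, so both words are
  constant.\<close>

lemma moment_equiv_snoc_Cons:
  assumes "moment_equiv 2 (tm_morph w @ [c]) (c' # tm_morph v)"
  shows "c = c' \<and> w = replicate (length w) c \<and> v = replicate (length v) (\<not> c)"
proof -
  have len: "length w = length v" and c: "c = c'"
    and eq: "- balance w + int (2 * length w) * sgnb c = - balance v"
    using assms coeff_1_word_poly_snoc[of "tm_morph w" c]
    unfolding moment_equiv_2_iff
    by (auto simp: coeff_1_word_poly_tm_morph coeff_1_word_poly_Cons simp del: word_poly.simps)
  have "balance w = sgnb c * int (length w)" "balance v = sgnb (\<not> c) * int (length v)"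
    using eq len balance_le[of c w] balance_le[of "\<not> c" v] by (cases c; simp)+
  then show ?thesis using c balance_extremal by blast
qed

section \<open>Infinite words as functions of the position\<close>

definition fac :: "(nat \<Rightarrow> bool) \<Rightarrow> nat \<Rightarrow> nat \<Rightarrow> bool list" where
  "fac s i n = map s [i..<i + n]"

text \<open>The morphism letter by letter: position \<open>n\<close> lies in the block of letter
  \<open>n div 2\<close>, and its second place carries the complement.\<close>

definition tm_fun :: "(nat \<Rightarrow> bool) \<Rightarrow> nat \<Rightarrow> bool" where
  "tm_fun s n = (s (n div 2) \<noteq> odd n)"

lemma tm_fun_simps [simp]: "tm_fun s (2 * i) = s i" "tm_fun s (Suc (2 * i)) = (\<not> s i)"
  by (simp_all add: tm_fun_def)

lemma length_fac [simp]: "length (fac s i n) = n"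
  by (simp add: fac_def)

lemma fac_0 [simp]: "fac s i 0 = []"
  by (simp add: fac_def)

lemma fac_Suc: "fac s i (Suc n) = s i # fac s (Suc i) n"
  by (simp add: fac_def upt_conv_Cons del: upt_Suc)

lemma fac_Suc_snoc: "fac s i (Suc n) = fac s i n @ [s (i + n)]"
  by (simp add: fac_def)

lemma fac_eq_iff: "fac s i n = fac t j n \<longleftrightarrow> (\<forall>p<n. s (i + p) = t (j + p))"
  by (auto simp: fac_def list_eq_iff_nth_eq)

lemma fac_eq_replicate_iff: "fac s i n = replicate n c \<longleftrightarrow> (\<forall>p<n. s (i + p) = c)"
  by (auto simp: fac_def list_eq_iff_nth_eq)

lemma fac_tm_fun_even: "fac (tm_fun s) (2 * i) (2 * n) = tm_morph (fac s i n)"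
proof (induction n arbitrary: i)
  case (Suc n)
  have "fac (tm_fun s) (2 * i) (2 * Suc n) = s i # (\<not> s i) # fac (tm_fun s) (2 * Suc i) (2 * n)"
    by (simp add: fac_Suc)
  then show ?case unfolding Suc.IH by (simp add: fac_Suc)
qed simp

lemma fac_tm_fun_even_odd:
  "fac (tm_fun s) (2 * i) (Suc (2 * n)) = tm_morph (fac s i n) @ [s (i + n)]"
proof -
  have "tm_fun s (2 * i + 2 * n) = s (i + n)" by (metis distrib_left tm_fun_simps(1))
  then show ?thesis unfolding fac_Suc_snoc fac_tm_fun_even by simp
qed

lemma fac_tm_fun_odd_odd:
  "fac (tm_fun s) (Suc (2 * i)) (Suc (2 * n)) = (\<not> s i) # tm_morph (fac s (Suc i) n)"
  using fac_tm_fun_even[of s "Suc i" n] by (simp add: fac_Suc)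

lemma fac_tm_fun_odd_even:
  "fac (tm_fun s) (Suc (2 * i)) (2 * Suc n)
     = (\<not> s i) # tm_morph (fac s (Suc i) n) @ [s (i + Suc n)]"
  using fac_tm_fun_even_odd[of s "Suc i" n] by (simp add: fac_Suc)

text \<open>Where the desubstitutions of the two factors are misaligned, the factors are the same word
  \<open>(c (\<not> c))\<^sup>n\<close> or \<open>(c (\<not> c))\<^sup>n c\<close>.\<close>

lemma moment_equiv_imp_binom_equiv_factors:
  assumes "moment_equiv (Suc K) (fac ((tm_fun ^^ K) s) i n) (fac ((tm_fun ^^ K) s) i' n)"
  shows "binom_equiv (Suc K) (fac ((tm_fun ^^ K) s) i n) (fac ((tm_fun ^^ K) s) i' n)"
  using assms
proof (induction K arbitrary: i i' n)
  case 0
  then show ?case using moment_equiv_one_imp_binom_equiv by simp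
next
  case (Suc K)
  define z where "z = (tm_fun ^^ K) s"
  have z: "(tm_fun ^^ Suc K) s = tm_fun z" by (simp add: z_def)
  have IH: "binom_equiv (Suc (Suc K)) (tm_morph (fac z p m)) (tm_morph (fac z q m))"
    if "moment_equiv (Suc K) (fac z p m) (fac z q m)" for p q m
    by (rule binom_equiv_tm_morph) (use Suc.IH that in \<open>simp_all add: z_def\<close>)
  \<comment> \<open>The claim for a single pair of offsets. The parities of both offsets and of the
    length leave six cases up to symmetry.\<close>
  define R where "R p q m \<longleftrightarrow> (moment_equiv (Suc (Suc K)) (fac (tm_fun z) p m) (fac (tm_fun z) q m) \<longrightarrow>
    binom_equiv (Suc (Suc K)) (fac (tm_fun z) p m) (fac (tm_fun z) q m))" for p q m
  have R_sym: "R p q m" if "R q p m" for p q m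
    using that unfolding R_def moment_equiv_iff_coeff binom_equiv_def by auto
  have R_same: "R p q m" if "fac (tm_fun z) p m = fac (tm_fun z) q m" for p q m
    using that by (simp add: R_def binom_equiv_def)
  have two: "moment_equiv 2 u v" if "moment_equiv (Suc (Suc K)) u v" for u v
    using that moment_equiv_mono[of "Suc (Suc K)" u v 2] by simp
  have ee: "R (2 * p) (2 * q) (2 * m)" for p q m
    unfolding R_def fac_tm_fun_even using IH by simp
  have eo: "R (2 * p) (Suc (2 * q)) (2 * m)" for p q m
  proof (cases m)
    case 0
    then show ?thesis by (simp add: R_same)
  next
    case (Suc m')
    show ?thesis unfolding R_def Suc fac_tm_fun_even fac_tm_fun_odd_even
    proof
      assume "moment_equiv (Suc (Suc K)) (tm_morph (fac z p (Suc m')))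
        ((\<not> z q) # tm_morph (fac z (Suc q) m') @ [z (q + Suc m')])"
      from moment_equiv_even_odd_offset[OF two[OF this]]
      have "(\<not> z q) = (\<not> z (q + Suc m'))" "fac z p (Suc m') = replicate (Suc m') (\<not> z (q + Suc m'))"
        "fac z (Suc q) m' = replicate m' (z (q + Suc m'))" by simp_all
      then have "tm_morph (fac z p (Suc m')) = (\<not> z q) # tm_morph (fac z (Suc q) m') @ [z (q + Suc m')]"
        using tm_morph_replicate_Suc[of m' "z (q + Suc m')"] by simp
      then show "binom_equiv (Suc (Suc K)) (tm_morph (fac z p (Suc m')))
        ((\<not> z q) # tm_morph (fac z (Suc q) m') @ [z (q + Suc m')])"
        by (simp add: binom_equiv_def)
    qed
  qed
  have oo: "R (Suc (2 * p)) (Suc (2 * q)) (2 * m)" for p q m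
  proof (cases m)
    case 0
    then show ?thesis by (simp add: R_same)
  next
    case (Suc m')
    show ?thesis unfolding R_def Suc fac_tm_fun_odd_even
    proof
      assume *: "moment_equiv (Suc (Suc K)) ((\<not> z p) # tm_morph (fac z (Suc p) m') @ [z (p + Suc m')])
        ((\<not> z q) # tm_morph (fac z (Suc q) m') @ [z (q + Suc m')])"
      from moment_equiv_odd_offset_ends[OF two[OF this]]
      have ends: "z p = z q" "z (p + Suc m') = z (q + Suc m')" by simp_all
      then have "moment_equiv (Suc K) (fac z (Suc p) m') (fac z (Suc q) m')"
        using * by simp
      then show "binom_equiv (Suc (Suc K)) ((\<not> z p) # tm_morph (fac z (Suc p) m') @ [z (p + Suc m')])
        ((\<not> z q) # tm_morph (fac z (Suc q) m') @ [z (q + Suc m')])"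
        unfolding ends by (intro binom_equiv_Cons binom_equiv_snoc IH)
    qed
  qed
  have ee': "R (2 * p) (2 * q) (Suc (2 * m))" for p q m
    unfolding R_def fac_tm_fun_even_odd
  proof
    assume *: "moment_equiv (Suc (Suc K)) (tm_morph (fac z p m) @ [z (p + m)])
       (tm_morph (fac z q m) @ [z (q + m)])"
    then have "z (p + m) = z (q + m)" using two[OF *] by (simp add: moment_equiv_2_iff)
    then show "binom_equiv (Suc (Suc K)) (tm_morph (fac z p m) @ [z (p + m)])
       (tm_morph (fac z q m) @ [z (q + m)])"
      using * IH by (simp add: binom_equiv_snoc)
  qed
  have oo': "R (Suc (2 * p)) (Suc (2 * q)) (Suc (2 * m))" for p q m
    unfolding R_def fac_tm_fun_odd_odd
  proof
    assume *: "moment_equiv (Suc (Suc K)) ((\<not> z p) # tm_morph (fac z (Suc p) m))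
       ((\<not> z q) # tm_morph (fac z (Suc q) m))"
    then have "z p = z q" using two[OF *] by (simp add: moment_equiv_2_iff)
    then show "binom_equiv (Suc (Suc K)) ((\<not> z p) # tm_morph (fac z (Suc p) m))
       ((\<not> z q) # tm_morph (fac z (Suc q) m))"
      using * IH by (simp add: binom_equiv_Cons)
  qed
  have eo': "R (2 * p) (Suc (2 * q)) (Suc (2 * m))" for p q m
    unfolding R_def fac_tm_fun_even_odd fac_tm_fun_odd_odd
  proof
    assume "moment_equiv (Suc (Suc K)) (tm_morph (fac z p m) @ [z (p + m)])
       ((\<not> z q) # tm_morph (fac z (Suc q) m))"
    from moment_equiv_snoc_Cons[OF two[OF this]]
    have "z (p + m) = (\<not> z q)" "fac z p m = replicate m (z (p + m))"
      "fac z (Suc q) m = replicate m (\<not> z (p + m))" by simp_all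
    then have "tm_morph (fac z p m) @ [z (p + m)] = (\<not> z q) # tm_morph (fac z (Suc q) m)"
      using tm_morph_replicate_snoc[of m "z (p + m)"] by simp
    then show "binom_equiv (Suc (Suc K)) (tm_morph (fac z p m) @ [z (p + m)])
       ((\<not> z q) # tm_morph (fac z (Suc q) m))"
      by (simp add: binom_equiv_def)
  qed
  have parity: "\<exists>h. x = 2 * h \<or> x = Suc (2 * h)" for x :: nat
    by (metis evenE oddE Suc_eq_plus1)
  have "R i i' n"
    using parity[of i] parity[of i'] parity[of n] ee eo oo ee' eo' oo' R_sym by metis
  then show ?case using Suc.prems unfolding R_def z by blast
qed

subsection \<open>Counting classes\<close>

text \<open>A complete invariant of the moment class among words of one length, so that counting
  classes becomes counting the values of a function.\<close>

definition mom :: "nat \<Rightarrow> bool list \<Rightarrow> int list" where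
  "mom j w = map (coeff (word_poly w)) [0..<j]"

lemma mom_eq_iff: "length u = length v \<Longrightarrow> mom j u = mom j v \<longleftrightarrow> moment_equiv j u v"
  by (auto simp: mom_def moment_equiv_iff_coeff)

lemma mom_1: "mom (Suc 0) w = [balance w]"
  by (simp add: mom_def coeff_0_word_poly)

definition classes :: "nat \<Rightarrow> (nat \<Rightarrow> bool) \<Rightarrow> nat \<Rightarrow> int list set" where
  "classes j s n = range (\<lambda>i. mom j (fac s i n))"

text \<open>An odd-offset window of length \<open>2 * n\<close> in the image sees half a block at
  each end and the full images of the \<open>n - 1\<close> letters between.\<close>

definition bordered_classes :: "nat \<Rightarrow> (nat \<Rightarrow> bool) \<Rightarrow> nat \<Rightarrow> (bool \<times> int list \<times> bool) set" where
  "bordered_classes j s n = range (\<lambda>i. (s i, mom j (fac s (Suc i) (n - 1)), s (i + n)))"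

text \<open>Both ranges are in bijection with the quotient of the index set by the common
  kernel.\<close>

lemma card_range_cong:
  assumes "\<And>i j. f i = f j \<longleftrightarrow> g i = g j"
  shows "card (range f) = card (range g)"
proof -
  define h where "h y = g (SOME i. f i = y)" for y
  have h: "h (f i) = g i" for i
  proof -
    have "f (SOME i'. f i' = f i) = f i" by (rule someI[of _ i]) simp
    then show ?thesis using assms by (simp add: h_def)
  qed
  have "range g = h ` range f" unfolding image_image h ..
  moreover have "inj_on h (range f)"
  proof (rule inj_onI)
    fix y y' assume "y \<in> range f" "y' \<in> range f" "h y = h y'"
    then show "y = y'" using assms h by (metis imageE)
  qed
  ultimately show ?thesis by (simp add: card_image)
qed

lemma range_even_odd: "range f = range (\<lambda>i. f (2 * i)) \<union> range (\<lambda>i. f (Suc (2 * i)))"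
proof -
  have "f x \<in> range (\<lambda>i. f (2 * i)) \<union> range (\<lambda>i. f (Suc (2 * i)))" for x :: nat
  proof -
    obtain h where "x = 2 * h \<or> x = Suc (2 * h)" by (metis evenE oddE Suc_eq_plus1)
    then show ?thesis by blast
  qed
  then show ?thesis by auto
qed

lemma finite_range_fac: "finite (range (\<lambda>i. g (fac s i n)))"
proof (rule finite_subset)
  show "range (\<lambda>i. g (fac s i n)) \<subseteq> g ` {w. set w \<subseteq> UNIV \<and> length w = n}"
    by (rule image_subsetI, rule imageI) simp
  show "finite (g ` {w. set w \<subseteq> UNIV \<and> length w = n})"
    by (rule finite_imageI, rule finite_lists_length_eq) simp
qed

lemma finite_classes [simp]: "finite (classes j s n)"
  unfolding classes_def by (rule finite_range_fac[of "mom j" s n])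

lemma finite_bordered_classes [simp]: "finite (bordered_classes j s n)"
proof -
  have "bordered_classes j s n \<subseteq> UNIV \<times> classes j s (n - 1) \<times> UNIV"
    unfolding bordered_classes_def classes_def by blast
  then show ?thesis
    by (rule finite_subset) simp
qed

text \<open>Excludes the pair of constant words whose images would give one class at offsets of both
  parities.\<close>

definition aligned :: "(nat \<Rightarrow> bool) \<Rightarrow> nat \<Rightarrow> bool" where
  "aligned s n \<longleftrightarrow> (\<forall>c i i'. \<not> ((\<forall>p<n. s (i + p) = c) \<and> (\<forall>p\<le>n. s (i' + p) = (\<not> c))))"

lemma alignedD:
  assumes "aligned s n" "\<forall>p<n. s (i + p) = (\<not> c)" "\<forall>p\<le>n. s (i' + p) = c"
  shows False
proof -
  have "\<not> ((\<forall>p<n. s (i + p) = (\<not> c)) \<and> (\<forall>p\<le>n. s (i' + p) = (\<not> \<not> c)))"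
    by (rule assms(1)[unfolded aligned_def, THEN spec, THEN spec, THEN spec])
  then show False using assms(2,3) by simp
qed

lemma classes_tm_fun:
  assumes "n \<ge> 1"
  shows "classes j (tm_fun s) (2 * n) =
     range (\<lambda>i. mom j (tm_morph (fac s i n))) \<union>
     range (\<lambda>i. mom j ((\<not> s i) # tm_morph (fac s (Suc i) (n - 1)) @ [s (i + n)]))"
proof -
  obtain m where "n = Suc m" using assms by (cases n) auto
  then show ?thesis
    unfolding classes_def
    by (subst range_even_odd) (simp only: fac_tm_fun_even fac_tm_fun_odd_even diff_Suc_1)
qed

lemma bordered_classes_tm_fun:
  assumes "n \<ge> 1"
  shows "bordered_classes j (tm_fun s) (2 * n) =
     range (\<lambda>i. (s i, mom j ((\<not> s i) # tm_morph (fac s (Suc i) (n - 1))), s (i + n))) \<union>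
     range (\<lambda>i. (\<not> s i, mom j (tm_morph (fac s (Suc i) (n - 1)) @ [s (i + n)]), \<not> s (i + n)))"
proof -
  obtain m where m: "n = Suc m" using assms by (cases n) auto
  have len: "2 * n - 1 = Suc (2 * m)" "n - 1 = m" using m by auto
  have ends: "tm_fun s (2 * i + 2 * n) = s (i + n)" "tm_fun s (Suc (2 * i) + 2 * n) = (\<not> s (i + n))" for i
    using tm_fun_simps[of s "i + n"] by (simp_all add: distrib_left)
  have mid: "fac (tm_fun s) (Suc (Suc (2 * i))) (Suc (2 * m))
      = tm_morph (fac s (Suc i) m) @ [s (i + n)]" for i
    using fac_tm_fun_even_odd[of s "Suc i" m] by (simp add: m)
  show ?thesis
    unfolding bordered_classes_def
    by (subst range_even_odd) (simp only: len ends mid tm_fun_simps fac_tm_fun_odd_odd)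
qed

lemma card_range_tm_morph:
  "card (range (\<lambda>i. mom (Suc j) (tm_morph (fac s i n)))) = card (classes j s n)"
  unfolding classes_def by (rule card_range_cong) (simp add: mom_eq_iff)

text \<open>From order 2 on, which \<open>j \<ge> 1\<close> ensures, a class determines both end
  letters; cancelling them leaves an image, whose order drops by one.\<close>

lemma card_range_odd_offset:
  assumes "j \<ge> 1"
  shows "card (range (\<lambda>i. mom (Suc j) ((\<not> s i) # tm_morph (fac s (Suc i) (n - 1)) @ [s (i + n)])))
    = card (bordered_classes j s n)"
  unfolding bordered_classes_def
proof (rule card_range_cong)
  fix i i'
  let ?u = "\<lambda>i. (\<not> s i) # tm_morph (fac s (Suc i) (n - 1)) @ [s (i + n)]"
  have "s i = s i' \<and> s (i + n) = s (i' + n)" if "moment_equiv (Suc j) (?u i) (?u i')"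
    using moment_equiv_odd_offset_ends[OF moment_equiv_mono[OF that, of 2]] assms by simp
  then show "mom (Suc j) (?u i) = mom (Suc j) (?u i') \<longleftrightarrow>
    (s i, mom j (fac s (Suc i) (n - 1)), s (i + n)) = (s i', mom j (fac s (Suc i') (n - 1)), s (i' + n))"
    by (auto simp: mom_eq_iff)
qed

lemma card_range_bordered_even:
  "card (range (\<lambda>i. (s i, mom (Suc j) ((\<not> s i) # tm_morph (fac s (Suc i) (n - 1))), s (i + n))))
    = card (bordered_classes j s n)"
  unfolding bordered_classes_def by (rule card_range_cong) (auto simp: mom_eq_iff)

lemma card_range_bordered_odd:
  "card (range (\<lambda>i. (\<not> s i, mom (Suc j) (tm_morph (fac s (Suc i) (n - 1)) @ [s (i + n)]), \<not> s (i + n))))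
    = card (bordered_classes j s n)"
  unfolding bordered_classes_def by (rule card_range_cong) (auto simp: mom_eq_iff)

lemma fac_all_eq_iff:
  assumes "n \<ge> 1"
  shows "(\<forall>p\<le>n. s (i + p) = c) \<longleftrightarrow>
    s i = c \<and> fac s (Suc i) (n - 1) = replicate (n - 1) c \<and> s (i + n) = c"
proof -
  obtain m where m: "n = Suc m" using assms by (cases n) auto
  have "(\<forall>p\<le>n. s (i + p) = c) \<longleftrightarrow> fac s i (Suc n) = replicate (Suc n) c"
    by (simp only: fac_eq_replicate_iff less_Suc_eq_le)
  also have "fac s i (Suc n) = s i # fac s (Suc i) m @ [s (i + n)]"
    using fac_Suc_snoc[of s "Suc i" m] by (simp add: m fac_Suc)
  also have "replicate (Suc n) c = c # replicate m c @ [c]"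
    by (simp add: m replicate_append_same)
  finally show ?thesis by (simp add: m)
qed

lemma mom_even_odd_offset_clash:
  assumes "mom (Suc j) (tm_morph (fac s i n))
      = mom (Suc j) ((\<not> s i') # tm_morph (fac s (Suc i') (n - 1)) @ [s (i' + n)])"
    and "j \<ge> 1" "n \<ge> 1"
  shows "(\<forall>p<n. s (i + p) = (\<not> s i')) \<and> (\<forall>p\<le>n. s (i' + p) = s i')"
proof -
  have "moment_equiv (Suc j) (tm_morph (fac s i n))
      ((\<not> s i') # tm_morph (fac s (Suc i') (n - 1)) @ [s (i' + n)])"
    by (rule mom_eq_iff[THEN iffD1]) (use assms in auto)
  from moment_equiv_even_odd_offset[OF moment_equiv_mono[OF this, of 2]]
  show ?thesis using assms by (auto simp: fac_all_eq_iff simp flip: fac_eq_replicate_iff)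
qed

lemma mom_bordered_clash:
  assumes "(s i, mom (Suc j) ((\<not> s i) # tm_morph (fac s (Suc i) (n - 1))), s (i + n))
    = (\<not> s i', mom (Suc j) (tm_morph (fac s (Suc i') (n - 1)) @ [s (i' + n)]), \<not> s (i' + n))"
    and "j \<ge> 1" "n \<ge> 1"
  shows "(\<forall>p\<le>n. s (i + p) = (\<not> s i')) \<and> (\<forall>p\<le>n. s (i' + p) = s i')"
proof -
  have "moment_equiv (Suc j) (tm_morph (fac s (Suc i') (n - 1)) @ [s (i' + n)])
      ((\<not> s i) # tm_morph (fac s (Suc i) (n - 1)))"
    by (rule mom_eq_iff[THEN iffD1]) (simp, metis assms(1) prod.inject)
  from moment_equiv_snoc_Cons[OF moment_equiv_mono[OF this, of 2]]
  show ?thesis using assms by (auto simp: fac_all_eq_iff)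
qed

text \<open>Even offsets contribute the classes of \<open>s\<close>, odd offsets its bordered
  classes, and alignment keeps the two families apart.\<close>

lemma card_classes_tm_fun:
  assumes "aligned s n" "n \<ge> 1" "j \<ge> 1"
  shows "card (classes (Suc j) (tm_fun s) (2 * n)) = card (classes j s n) + card (bordered_classes j s n)"
proof -
  let ?A = "range (\<lambda>i. mom (Suc j) (tm_morph (fac s i n)))"
  let ?B = "range (\<lambda>i. mom (Suc j) ((\<not> s i) # tm_morph (fac s (Suc i) (n - 1)) @ [s (i + n)]))"
  have "?A \<inter> ?B = {}"
  proof (intro equals0I)
    fix y assume "y \<in> ?A \<inter> ?B"
    then obtain i i' where "y = mom (Suc j) (tm_morph (fac s i n))"
      "y = mom (Suc j) ((\<not> s i') # tm_morph (fac s (Suc i') (n - 1)) @ [s (i' + n)])"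
      by blast
    then have "(\<forall>p<n. s (i + p) = (\<not> s i')) \<and> (\<forall>p\<le>n. s (i' + p) = s i')"
      by (intro mom_even_odd_offset_clash[OF _ assms(3,2)]) simp
    then show False using alignedD[OF assms(1)] by blast
  qed
  moreover have "finite ?A" "finite ?B"
    using finite_classes[of "Suc j" "tm_fun s" "2 * n"] unfolding classes_tm_fun[OF assms(2)] by simp_all
  ultimately show ?thesis
    unfolding classes_tm_fun[OF assms(2)]
    by (simp only: card_Un_disjoint card_range_tm_morph card_range_odd_offset[OF assms(3)])
qed

text \<open>Offsets of either parity reproduce all bordered classes of \<open>s\<close>, and
  alignment makes the two copies disjoint.\<close>

lemma card_bordered_classes_tm_fun:
  assumes "aligned s n" "n \<ge> 1" "j \<ge> 1"
  shows "card (bordered_classes (Suc j) (tm_fun s) (2 * n)) = 2 * card (bordered_classes j s n)"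
proof -
  let ?A = "range (\<lambda>i. (s i, mom (Suc j) ((\<not> s i) # tm_morph (fac s (Suc i) (n - 1))), s (i + n)))"
  let ?B = "range (\<lambda>i. (\<not> s i, mom (Suc j) (tm_morph (fac s (Suc i) (n - 1)) @ [s (i + n)]), \<not> s (i + n)))"
  have "?A \<inter> ?B = {}"
  proof (intro equals0I)
    fix y assume "y \<in> ?A \<inter> ?B"
    then obtain i i' where
      "y = (s i, mom (Suc j) ((\<not> s i) # tm_morph (fac s (Suc i) (n - 1))), s (i + n))"
      "y = (\<not> s i', mom (Suc j) (tm_morph (fac s (Suc i') (n - 1)) @ [s (i' + n)]), \<not> s (i' + n))"
      by blast
    then have "(\<forall>p\<le>n. s (i + p) = (\<not> s i')) \<and> (\<forall>p\<le>n. s (i' + p) = s i')"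
      by (intro mom_bordered_clash[OF _ assms(3,2)]) simp
    then show False using alignedD[OF assms(1), of i "s i'" i'] by simp
  qed
  moreover have "finite ?A" "finite ?B"
    using finite_bordered_classes[of "Suc j" "tm_fun s" "2 * n"]
    unfolding bordered_classes_tm_fun[OF assms(2)] by simp_all
  ultimately show ?thesis
    unfolding bordered_classes_tm_fun[OF assms(2)]
    by (simp only: card_Un_disjoint card_range_bordered_even card_range_bordered_odd mult_2)
qed

text \<open>Three consecutive letters of an image contain a whole block, hence two different
  letters.\<close>

lemma aligned_tm_fun:
  assumes "n \<ge> 2"
  shows "aligned (tm_fun s) n"
  unfolding aligned_def
proof (intro allI notI)
  fix c i i' assume "(\<forall>p<n. tm_fun s (i + p) = c) \<and> (\<forall>p\<le>n. tm_fun s (i' + p) = (\<not> c))"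
  then have *: "tm_fun s (i' + p) = (\<not> c)" if "p \<le> 2" for p using assms that by simp
  obtain h where "i' = 2 * h \<or> i' = Suc (2 * h)" by (metis evenE oddE Suc_eq_plus1)
  then show False
    using *[of 0] *[of 1] *[of 2] tm_fun_simps[of s h] tm_fun_simps[of s "Suc h"] by auto
qed

text \<open>Each level adds the bordered count T to the class count and doubles T, so the increments
  sum to (2^K - 1) T. Alignment is assumed at the bottom only; above it the word is an
  image.\<close>

lemma card_classes_tm_fun_power:
  assumes "aligned s n" "n \<ge> 2" "j \<ge> 1"
  shows "card (classes (j + K) ((tm_fun ^^ K) s) (2 ^ K * n))
      = card (classes j s n) + (2 ^ K - 1) * card (bordered_classes j s n)"
    and "card (bordered_classes (j + K) ((tm_fun ^^ K) s) (2 ^ K * n)) = 2 ^ K * card (bordered_classes j s n)"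
proof (induction K)
  case (Suc K)
  have n: "2 ^ K * n \<ge> 2" using assms(2) by (metis mult_le_mono one_le_numeral one_le_power mult_1)
  have al: "aligned ((tm_fun ^^ K) s) (2 ^ K * n)"
    using n assms(1) by (cases K) (auto intro: aligned_tm_fun)
  have eq: "2 ^ Suc K * n = 2 * (2 ^ K * n)" "j + Suc K = Suc (j + K)"
    "(tm_fun ^^ Suc K) s = tm_fun ((tm_fun ^^ K) s)" by simp_all
  have n1: "2 ^ K * n \<ge> 1" "j + K \<ge> 1" using n assms(3) by linarith+
  obtain P where P: "(2 :: nat) ^ K = Suc P" by (metis not0_implies_Suc power_not_zero zero_neq_numeral)
  show "card (classes (j + Suc K) ((tm_fun ^^ Suc K) s) (2 ^ Suc K * n))
      = card (classes j s n) + (2 ^ Suc K - 1) * card (bordered_classes j s n)"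
    unfolding eq card_classes_tm_fun[OF al n1] Suc.IH by (simp add: P algebra_simps)
  show "card (bordered_classes (j + Suc K) ((tm_fun ^^ Suc K) s) (2 ^ Suc K * n))
      = 2 ^ Suc K * card (bordered_classes j s n)"
    unfolding eq card_bordered_classes_tm_fun[OF al n1] Suc.IH by simp
qed simp_all

subsection \<open>Balances and recurrence\<close>

definition walk :: "(nat \<Rightarrow> bool) \<Rightarrow> nat \<Rightarrow> int" where
  "walk s n = (\<Sum>p<n. sgnb (s p))"

lemma walk_Suc [simp]: "walk s (Suc n) = walk s n + sgnb (s n)"
  by (simp add: walk_def)

lemma balance_fac: "balance (fac s i n) = walk s (i + n) - walk s i"
  by (induction n) (auto simp: fac_Suc_snoc)

definition balances :: "(nat \<Rightarrow> bool) \<Rightarrow> nat \<Rightarrow> int set" where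
  "balances s n = range (\<lambda>i. walk s (i + n) - walk s i)"

text \<open>Together with \<open>left_bordered\<close> this describes the order-two classes of
  odd-length windows of the image, which end or begin with half a block.\<close>

definition right_bordered :: "(nat \<Rightarrow> bool) \<Rightarrow> nat \<Rightarrow> (int \<times> bool) set" where
  "right_bordered s n = range (\<lambda>i. (walk s (i + n) - walk s i, s (i + n)))"

definition left_bordered :: "(nat \<Rightarrow> bool) \<Rightarrow> nat \<Rightarrow> (bool \<times> int) set" where
  "left_bordered s n = range (\<lambda>i. (s i, walk s (Suc i + n) - walk s (Suc i)))"

definition bordered :: "(nat \<Rightarrow> bool) \<Rightarrow> nat \<Rightarrow> (bool \<times> int \<times> bool) set" where
  "bordered s n = range (\<lambda>i. (s i, walk s (i + n) - walk s (Suc i), s (i + n)))"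

lemma classes_1: "classes (Suc 0) s n = (\<lambda>v. [v]) ` balances s n"
  by (simp add: classes_def balances_def mom_1 balance_fac image_image)

lemma card_classes_1: "card (classes (Suc 0) s n) = card (balances s n)"
  unfolding classes_1 by (rule card_image) (simp add: inj_on_def)

lemma card_bordered_classes_1:
  assumes "n \<ge> 1"
  shows "card (bordered_classes (Suc 0) s n) = card (bordered s n)"
proof -
  have "Suc i + (n - 1) = i + n" for i using assms by simp
  then have "bordered_classes (Suc 0) s n = (\<lambda>(a, v, b). (a, [v], b)) ` bordered s n"
    by (simp only: bordered_classes_def bordered_def mom_1 balance_fac image_image prod.case)
  then show ?thesis by (simp add: card_image inj_on_def split_beta prod_eq_iff)
qed

lemma finite_balances [simp]: "finite (balances s n)"
  using finite_classes[of "Suc 0" s n] unfolding classes_1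
  by (rule finite_imageD) (simp add: inj_on_def)

lemma right_bordered_subset: "right_bordered s n \<subseteq> balances s n \<times> UNIV"
  unfolding right_bordered_def balances_def by blast

lemma left_bordered_subset: "left_bordered s n \<subseteq> UNIV \<times> balances s n"
  unfolding left_bordered_def balances_def by blast

lemma finite_right_bordered [simp]: "finite (right_bordered s n)"
  by (rule finite_subset[OF right_bordered_subset]) simp

lemma finite_left_bordered [simp]: "finite (left_bordered s n)"
  by (rule finite_subset[OF left_bordered_subset]) simp

lemma finite_bordered [simp]: "finite (bordered s n)"
proof (cases n)
  case 0
  then have "bordered s n \<subseteq> UNIV \<times> {-1, 1} \<times> UNIV" by (auto simp: bordered_def sgnb_def)
  then show ?thesis by (rule finite_subset) simp
next
  case (Suc m)
  then have "bordered s n \<subseteq> UNIV \<times> balances s m \<times> UNIV"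
    by (auto simp: bordered_def balances_def intro!: image_eqI[of _ _ "Suc _"])
  then show ?thesis by (rule finite_subset) simp
qed

lemma balances_nonempty [simp]: "balances s n \<noteq> {}"
  by (simp add: balances_def)

lemma balances_Suc: "balances s (Suc n) = (\<lambda>(v, b). v + sgnb b) ` right_bordered s n"
  by (simp add: balances_def right_bordered_def image_image algebra_simps)

text \<open>Recurrence for words as functions: every window reappears arbitrarily far to the
  right.\<close>

definition recur :: "(nat \<Rightarrow> bool) \<Rightarrow> bool" where
  "recur s \<longleftrightarrow> (\<forall>i n m. \<exists>i'\<ge>m. \<forall>p<n. s (i' + p) = s (i + p))"

lemma recur_walk:
  assumes "recur s"
  shows "\<exists>i'\<ge>m. walk s (i' + n) - walk s i' = walk s (i + n) - walk s i"
proof -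
  obtain i' where "i' \<ge> m" "\<forall>p<n. s (i' + p) = s (i + p)"
    using assms unfolding recur_def by blast
  then have "fac s i' n = fac s i n" by (simp add: fac_eq_iff)
  then show ?thesis using \<open>i' \<ge> m\<close> balance_fac by metis
qed

lemma discrete_crossing:
  fixes f :: "nat \<Rightarrow> int"
  assumes "i \<le> j" "f i \<le> v" "v < f j"
  shows "\<exists>k. f k \<le> v \<and> v < f (Suc k)"
  using assms
proof (induction j)
  case (Suc j)
  show ?case
  proof (cases "v < f j")
    case True
    then have "i \<noteq> Suc j" using Suc.prems by auto
    then show ?thesis using Suc True by simp
  qed (use Suc.prems in \<open>auto intro: exI[of _ j]\<close>)
qed simp

text \<open>Recurrence makes the balance of a sliding window come back from every value to every other one,
  hence move both up and down between any two consecutive values.\<close>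

lemma crossings:
  assumes "recur s" "v \<in> balances s n" "w \<in> balances s n" "v < w"
  shows "\<exists>i. walk s (i + n) - walk s i = v \<and> \<not> s i \<and> s (i + n)"
    and "\<exists>i. walk s (i + n) - walk s i = w \<and> s i \<and> \<not> s (i + n)"
proof -
  define f where "f i = walk s (i + n) - walk s i" for i
  have Suc: "f (Suc i) = f i + sgnb (s (i + n)) - sgnb (s i)" for i
    by (simp add: f_def)
  \<comment> \<open>Sliding changes the balance by 0, 2 or -2, so a crossing of \<open>v\<close>
    must start exactly at \<open>v\<close>.\<close>
  have parity: "even (f i - f 0)" for i
    by (induction i) (auto simp: Suc sgnb_def)
  obtain i j where i: "v = f i" and j: "w = f j"
    using assms(2,3) by (auto simp: balances_def f_def)
  have ev: "even (f k - f l)" for k l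
    using parity[of k] parity[of l] by presburger
  \<comment> \<open>Recurrence brings the value \<open>w\<close> back after position
    \<open>i\<close>, whatever the order of \<open>i\<close> and \<open>j\<close>.\<close>
  obtain j' where j': "j' \<ge> i" "f j' = w"
    using recur_walk[OF assms(1), where n = n and i = j] unfolding f_def[symmetric] j by blast
  obtain i' where i': "i' \<ge> j" "f i' = v"
    using recur_walk[OF assms(1), where n = n and i = i] unfolding f_def[symmetric] i by blast
  obtain k where k: "f k \<le> v" "v < f (Suc k)"
    using discrete_crossing[of i j' f v] j' i assms(4) by auto
  have "f k = v \<and> \<not> s k \<and> s (k + n)"
    using k ev[of k i] unfolding Suc i
    by (cases "s k"; cases "s (k + n)"; simp; presburger)
  then show "\<exists>i. walk s (i + n) - walk s i = v \<and> \<not> s i \<and> s (i + n)" unfolding f_def by blast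
  \<comment> \<open>A downward crossing of \<open>f\<close> is an upward crossing of its
    negative.\<close>
  obtain l where l: "- f l \<le> - w" "- w < - f (Suc l)"
    using discrete_crossing[of j i' "\<lambda>i. - f i" "- w"] i' j assms(4) by auto
  have "f l = w \<and> s l \<and> \<not> s (l + n)"
    using l ev[of l j] unfolding Suc j
    by (cases "s l"; cases "s (l + n)"; simp; presburger)
  then show "\<exists>i. walk s (i + n) - walk s i = w \<and> s i \<and> \<not> s (i + n)" unfolding f_def by blast
qed

text \<open>All four facts are read off a single window that loses a 0 on the left and gains a 1 on
  the right.\<close>

lemma up_step:
  assumes "recur s" "v \<in> balances s n" "w \<in> balances s n" "v < w"
  shows "v + 2 \<in> balances s n" "(v, True) \<in> right_bordered s n"
    "(False, v + 2) \<in> left_bordered s n" "(False, v + 1, True) \<in> bordered s n"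
proof -
  obtain i where i: "walk s (i + n) - walk s i = v" "\<not> s i" "s (i + n)"
    using crossings(1)[OF assms] by blast
  then have eq: "walk s (Suc i + n) - walk s (Suc i) = v + 2" "walk s (i + n) - walk s (Suc i) = v + 1"
    by simp_all
  show "v + 2 \<in> balances s n" unfolding balances_def by (rule range_eqI[of _ _ "Suc i"]) (rule eq(1)[symmetric])
  show "(v, True) \<in> right_bordered s n" unfolding right_bordered_def by (rule range_eqI[of _ _ i]) (simp add: i)
  show "(False, v + 2) \<in> left_bordered s n" unfolding left_bordered_def
    by (rule range_eqI[of _ _ i]) (simp only: eq i)
  show "(False, v + 1, True) \<in> bordered s n" unfolding bordered_def
    by (rule range_eqI[of _ _ i]) (simp only: eq i)
qed

lemma down_step:
  assumes "recur s" "v \<in> balances s n" "w \<in> balances s n" "v < w"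
  shows "w - 2 \<in> balances s n" "(w, False) \<in> right_bordered s n"
    "(True, w - 2) \<in> left_bordered s n" "(True, w - 1, False) \<in> bordered s n"
proof -
  obtain i where i: "walk s (i + n) - walk s i = w" "s i" "\<not> s (i + n)"
    using crossings(2)[OF assms] by blast
  then have eq: "walk s (Suc i + n) - walk s (Suc i) = w - 2" "walk s (i + n) - walk s (Suc i) = w - 1"
    by simp_all
  show "w - 2 \<in> balances s n" unfolding balances_def by (rule range_eqI[of _ _ "Suc i"]) (rule eq(1)[symmetric])
  show "(w, False) \<in> right_bordered s n" unfolding right_bordered_def by (rule range_eqI[of _ _ i]) (simp add: i)
  show "(True, w - 2) \<in> left_bordered s n" unfolding left_bordered_def
    by (rule range_eqI[of _ _ i]) (simp only: eq i)
  show "(True, w - 1, False) \<in> bordered s n" unfolding bordered_def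
    by (rule range_eqI[of _ _ i]) (simp only: eq i)
qed

lemma nonmax_less: "v \<in> V - {Max V} \<Longrightarrow> finite V \<Longrightarrow> v < Max (V :: int set)"
  by (metis DiffD1 DiffD2 Max_ge insertI1 order_less_le)

lemma nonmin_greater: "v \<in> V - {Min V} \<Longrightarrow> finite V \<Longrightarrow> Min (V :: int set) < v"
  by (metis DiffD1 DiffD2 Min_le insertI1 order_less_le)

text \<open>Every value except the maximum starts an upward move and every value except the minimum
  a downward one; the border letters tell the moves apart.\<close>

lemma card_bordered_ge:
  assumes "recur s"
  shows "2 * (card (balances s n) - 1) \<le> card (bordered s n)"
proof -
  let ?V = "balances s n"
  let ?A = "(\<lambda>v. (False, v + 1, True)) ` (?V - {Max ?V})"
  let ?B = "(\<lambda>v. (True, v - 1, False)) ` (?V - {Min ?V})"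
  have "?A \<subseteq> bordered s n"
    using up_step(4)[OF assms, of _ n "Max ?V"] nonmax_less[of _ ?V] by (auto simp: Max_in)
  moreover have "?B \<subseteq> bordered s n"
    using down_step(4)[OF assms, of "Min ?V" n] nonmin_greater[of _ ?V] by (auto simp: Min_in)
  ultimately have "card (?A \<union> ?B) \<le> card (bordered s n)" by (intro card_mono) auto
  moreover have "card (?A \<union> ?B) = card ?A + card ?B" by (rule card_Un_disjoint) auto
  moreover have "card ?A = card ?V - 1"
    by (subst card_image) (auto simp: inj_on_def Max_in card_Diff_singleton)
  moreover have "card ?B = card ?V - 1"
    by (subst card_image) (auto simp: inj_on_def Min_in card_Diff_singleton)
  ultimately show ?thesis by simp
qed

section \<open>From one window length to the next\<close>

lemma balances_Suc_subset: "balances s (Suc n) \<subseteq> (\<lambda>v. v - 1) ` balances s n \<union> (\<lambda>v. v + 1) ` balances s n"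
proof
  fix w assume "w \<in> balances s (Suc n)"
  then obtain v b where vb: "(v, b) \<in> right_bordered s n" "w = v + sgnb b"
    unfolding balances_Suc by auto
  then have "v \<in> balances s n" using right_bordered_subset[of s n] by blast
  then show "w \<in> (\<lambda>v. v - 1) ` balances s n \<union> (\<lambda>v. v + 1) ` balances s n"
    using vb(2) by (cases b) simp_all
qed

lemma balances_Suc_witness:
  assumes "v \<in> balances s n"
  shows "v - 1 \<in> balances s (Suc n) \<or> v + 1 \<in> balances s (Suc n)"
proof -
  obtain i where i: "v = walk s (i + n) - walk s i" using assms by (auto simp: balances_def)
  have "walk s (i + Suc n) - walk s i \<in> balances s (Suc n)" unfolding balances_def by blast
  moreover have "walk s (i + Suc n) - walk s i = v + sgnb (s (i + n))" by (simp add: i)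
  ultimately have "v + sgnb (s (i + n)) \<in> balances s (Suc n)" by (simp only:)
  then show ?thesis by (cases "s (i + n)") simp_all
qed

lemma balances_odd_step_card:
  assumes "balances s n = {-1, 1}" "card (balances s (Suc n)) = 3"
  shows "balances s (Suc n) = {-2, 0, 2}"
proof (rule card_subset_eq)
  show "balances s (Suc n) \<subseteq> {-2, 0, 2}" using balances_Suc_subset[of s n] assms(1) by auto
qed (use assms in auto)

text \<open>The values 2 and -2 leave a neighbour on each side of 0. Since recurrence allows no
  gaps, -3 or 3 would give a third value.\<close>

lemma balances_even_step_card:
  assumes "recur s" "balances s n = {-2, 0, 2}" "card (balances s (Suc n)) = 2"
  shows "balances s (Suc n) = {-1, 1}"
proof -
  let ?V = "balances s (Suc n)"
  have sub: "?V \<subseteq> {-3, -1, 1, 3}" using balances_Suc_subset[of s n] assms(2) by auto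
  have low: "-3 \<in> ?V \<or> -1 \<in> ?V" using balances_Suc_witness[of "-2" s n] assms(2) by simp
  have high: "1 \<in> ?V \<or> 3 \<in> ?V" using balances_Suc_witness[of "2" s n] assms(2) by simp
  have three: False if "{a, b, c} \<subseteq> ?V" "a < b" "b < c" for a b c :: int
  proof -
    have "card {a, b, c} \<le> card ?V" by (rule card_mono) (use that in auto)
    then show False using that(2,3) assms(3) by simp
  qed
  have "-3 \<notin> ?V"
  proof
    assume *: "-3 \<in> ?V"
    from high obtain w where "w \<in> ?V" "w \<ge> 1" by auto
    then show False using up_step(1)[OF assms(1) *, of w] three[of "-3" "-1" w] * by simp
  qed
  moreover have "3 \<notin> ?V"
  proof
    assume *: "3 \<in> ?V"
    from low obtain w where "w \<in> ?V" "w \<le> -1" by auto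
    then show False using down_step(1)[OF assms(1) _ *, of w] three[of w 1 3] * by simp
  qed
  ultimately show ?thesis using sub low high by auto
qed

text \<open>Both sets lie in products of size 4, so a total of 8 makes the right-bordered pairs
  exhaust theirs.\<close>

lemma balances_odd_step_bordered:
  assumes "balances s n = {-1, 1}" "card (right_bordered s n) + card (left_bordered s n) = 8"
  shows "balances s (Suc n) = {-2, 0, 2}"
proof -
  have "card (right_bordered s n) \<le> card ({-1, 1 :: int} \<times> (UNIV :: bool set))"
    using right_bordered_subset[of s n] assms(1) by (intro card_mono) auto
  moreover have "card (left_bordered s n) \<le> card ((UNIV :: bool set) \<times> {-1, 1 :: int})"
    using left_bordered_subset[of s n] assms(1) by (intro card_mono) auto
  ultimately have "card (right_bordered s n) = card ({-1, 1 :: int} \<times> (UNIV :: bool set))"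
    using assms(2) by (simp add: card_cartesian_product)
  then have "right_bordered s n = {-1, 1} \<times> UNIV"
    using right_bordered_subset[of s n] assms(1) by (intro card_subset_eq) auto
  then show ?thesis unfolding balances_Suc by (auto simp: UNIV_bool)
qed

text \<open>Up and down moves already supply four pairs on each side, so there are no others; in
  particular 2 is followed only by 0 and -2 only by 1.\<close>

lemma balances_even_step_bordered:
  assumes "recur s" "balances s n = {-2, 0, 2}"
    and "card (right_bordered s n) + card (left_bordered s n) = 8"
  shows "balances s (Suc n) = {-1, 1}"
proof -
  have in_bal: "-2 \<in> balances s n" "0 \<in> balances s n" "2 \<in> balances s n" using assms(2) by auto
  let ?R = "{(-2, True), (0, True), (2, False), (0 :: int, False)}"
  have R: "?R \<subseteq> right_bordered s n"
    using up_step(2)[OF assms(1) in_bal(1,2)] up_step(2)[OF assms(1) in_bal(2,3)]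
      down_step(2)[OF assms(1) in_bal(1,2)] down_step(2)[OF assms(1) in_bal(2,3)] by simp
  let ?L = "{(False, 0), (False, 2), (True, 0), (True, -2 :: int)}"
  have L: "?L \<subseteq> left_bordered s n"
    using up_step(3)[OF assms(1) in_bal(1,2)] up_step(3)[OF assms(1) in_bal(2,3)]
      down_step(3)[OF assms(1) in_bal(1,2)] down_step(3)[OF assms(1) in_bal(2,3)] by simp
  have "card ?R \<le> card (right_bordered s n)" using R by (intro card_mono) auto
  moreover have "card ?L \<le> card (left_bordered s n)" using L by (intro card_mono) auto
  ultimately have "card (right_bordered s n) = card ?R" using assms(3) by simp
  then have "?R = right_bordered s n" using R by (intro card_subset_eq) auto
  then show ?thesis unfolding balances_Suc by (auto simp flip: \<open>?R = right_bordered s n\<close>)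
qed

text \<open>If the walk takes two different values at positions of one parity, then at all positions of the
  other parity it takes the value between them.\<close>

lemma tail_eq_tm_fun:
  assumes "\<And>n. odd n \<Longrightarrow> balances s n \<subseteq> {-1, 1}"
  shows "\<exists>e\<le>1. \<exists>z. \<forall>n. s (e + n) = tm_fun z n"
proof -
  have step: "\<bar>walk s j - walk s i\<bar> = 1" if "odd (i + j)" for i j
  proof -
    have *: "\<bar>walk s b - walk s a\<bar> = 1" if "a \<le> b" "odd (a + b)" for a b
    proof -
      have "odd (b - a)" using that by auto
      moreover have "walk s b - walk s a \<in> balances s (b - a)"
        unfolding balances_def using that(1) by (intro range_eqI[of _ _ a]) simp
      ultimately show ?thesis using assms[of "b - a"] by auto
    qed
    show ?thesis
    proof (cases "i \<le> j")
      case False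
      then have "\<bar>walk s i - walk s j\<bar> = 1" using *[of j i] that by (simp add: add.commute)
      then show ?thesis by simp
    qed (use * that in blast)
  qed
  have "\<exists>e\<le>1. \<forall>i. walk s (e + 2 * i) = walk s e"
  proof (rule ccontr)
    assume not: "\<not> ?thesis"
    obtain i where i: "walk s (2 * i) \<noteq> walk s 0"
      using not by (metis add_0 zero_le_one)
    obtain j where j: "walk s (1 + 2 * j) \<noteq> walk s 1" using not by (metis order_refl)
    show False
      using i j step[of 0 1] step[of 0 "1 + 2 * j"] step[of "2 * i" 1] step[of "2 * i" "1 + 2 * j"]
      by simp
  qed
  then obtain e where e: "e \<le> 1" "\<And>i. walk s (e + 2 * i) = walk s e" by blast
  \<comment> \<open>The walk returns to its value after each pair of letters from \<open>e\<close>
    on, so the two letters of a pair differ.\<close>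
  have "s (e + n) = tm_fun (\<lambda>i. s (e + 2 * i)) n" for n
  proof -
    obtain h where h: "n = 2 * h \<or> n = Suc (2 * h)" by (metis evenE oddE Suc_eq_plus1)
    have "walk s (e + 2 * Suc h) = walk s (e + 2 * h)" using e(2) by metis
    then have "sgnb (s (e + 2 * h)) + sgnb (s (Suc (e + 2 * h))) = 0" by simp
    then have "s (Suc (e + 2 * h)) = (\<not> s (e + 2 * h))"
      by (auto simp: sgnb_def split: if_splits)
    then show ?thesis using h by auto
  qed
  then show ?thesis using e(1) by blast
qed

text \<open>Two equal adjacent letters of an image start at an odd position. A factor containing
  such a square therefore reappears only at offsets of the same parity, so its copies descend to
  \<open>z\<close>.\<close>

lemma recur_tm_fun_imp_recur:
  assumes "recur (tm_fun z)" "tm_fun z q = tm_fun z (Suc q)"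
  shows "recur z"
  unfolding recur_def
proof (intro allI)
  fix i n m
  \<comment> \<open>The square is moved past the window, so that one factor starting at
    \<open>2 * i\<close> contains both.\<close>
  obtain q' where q': "q' \<ge> 2 * (i + n)" "\<forall>p<2. tm_fun z (q' + p) = tm_fun z (q + p)"
    using assms(1) unfolding recur_def by blast
  have sq: "tm_fun z q' = tm_fun z (Suc q')"
    using q'(2)[rule_format, of 0] q'(2)[rule_format, of 1] assms(2) by simp
  have square_odd: "odd p" if "tm_fun z p = tm_fun z (Suc p)" for p
    using that by (auto elim!: evenE)
  obtain i' where i': "i' \<ge> 2 * m"
    "\<forall>p<q' + 2 - 2 * i. tm_fun z (i' + p) = tm_fun z (2 * i + p)"
    using assms(1) unfolding recur_def by blast
  have "tm_fun z (i' + (q' - 2 * i)) = tm_fun z (Suc (i' + (q' - 2 * i)))"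
    using i'(2)[rule_format, of "q' - 2 * i"] i'(2)[rule_format, of "Suc (q' - 2 * i)"] q'(1) sq by simp
  then have "odd (i' + (q' - 2 * i))" by (rule square_odd)
  moreover have "odd q'" using sq by (rule square_odd)
  ultimately have "even i'" using q'(1) by auto
  then obtain h where h: "i' = 2 * h" by (rule evenE)
  have "z (h + p) = z (i + p)" if "p < n" for p
  proof -
    have "tm_fun z (2 * h + 2 * p) = tm_fun z (2 * i + 2 * p)"
      using i'(2)[rule_format, of "2 * p"] that q'(1) h by simp
    then show ?thesis by (metis distrib_left tm_fun_simps(1))
  qed
  then show "\<exists>i'\<ge>m. \<forall>p<n. z (i' + p) = z (i + p)" using i'(1) h by (intro exI[of _ h]) simp
qed

subsection \<open>The Thue--Morse word\<close>

text \<open>The balance and border data of a window of the image depend on at most two seed letters,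
  so this property fixes all the sets counted below.\<close>

definition all_pairs :: "(nat \<Rightarrow> bool) \<Rightarrow> bool" where
  "all_pairs z \<longleftrightarrow> (\<forall>n\<ge>1. \<forall>a b. \<exists>i. z i = a \<and> z (i + n) = b)"

lemma range_all_pairs:
  assumes "all_pairs z" "n \<ge> 1"
  shows "range (\<lambda>i. g (z i) (z (i + n))) = {g False False, g False True, g True False, g True True}"
proof -
  have "range (\<lambda>i. g (z i) (z (i + n))) = range (\<lambda>(a, b). g a b)"
  proof (intro equalityI subsetI)
    fix y assume "y \<in> range (\<lambda>(a, b). g a b)"
    then obtain a b where "y = g a b" by auto
    moreover obtain i where "z i = a" "z (i + n) = b"
      using assms unfolding all_pairs_def by blast
    ultimately show "y \<in> range (\<lambda>i. g (z i) (z (i + n)))" by blast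
  qed auto
  also have "(UNIV :: (bool \<times> bool) set) = {(False, False), (False, True), (True, False), (True, True)}"
    by auto
  finally show ?thesis by simp
qed

lemma walk_tm_fun [simp]:
  "walk (tm_fun z) (2 * i) = 0" "walk (tm_fun z) (Suc (2 * i)) = sgnb (z i)"
proof -
  show *: "walk (tm_fun z) (2 * i) = 0" for i
  proof (induction i)
    case (Suc i)
    have "walk (tm_fun z) (2 * Suc i) = walk (tm_fun z) (2 * i) + sgnb (tm_fun z (2 * i)) + sgnb (tm_fun z (Suc (2 * i)))"
      by simp
    then show ?case by (simp only: Suc tm_fun_simps) simp
  qed (simp add: walk_def)
  show "walk (tm_fun z) (Suc (2 * i)) = sgnb (z i)" by (simp add: *)
qed

text \<open>Brings positions into the doubled form on which the rules for \<open>tm_fun\<close> and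
  \<open>walk\<close> act.\<close>

lemma double_sums:
  "2 * i + 2 * n = 2 * (i + n)" "Suc (2 * i) + 2 * n = Suc (2 * (i + n))"
  "2 * i + Suc (2 * n) = Suc (2 * (i + n))" "Suc (2 * i) + Suc (2 * n) = 2 * (i + Suc n)"
  "Suc (Suc (2 * i)) = 2 * Suc i"
  for i n :: nat
  by simp_all

lemma balances_tm_fun:
  assumes "all_pairs z"
  shows "n \<ge> 1 \<Longrightarrow> balances (tm_fun z) (2 * n) = {-2, 0, 2}"
    and "balances (tm_fun z) (Suc (2 * n)) = {-1, 1}"
proof -
  have 1: "range (\<lambda>i. sgnb (z (i + n)) - sgnb (z i)) = {-2, 0, 2}" if "n \<ge> 1" for n
    unfolding range_all_pairs[OF assms that, of "\<lambda>a b. sgnb b - sgnb a"] by auto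
  show "balances (tm_fun z) (2 * n) = {-2, 0, 2}" if "n \<ge> 1"
    unfolding balances_def
    by (subst range_even_odd) (simp only: double_sums walk_tm_fun 1[OF that], auto)
  \<comment> \<open>The pair is taken at distance \<open>Suc n\<close>, since \<open>n\<close> may
    be 0 and \<open>all_pairs\<close> speaks of positive distances only.\<close>
  have b: "\<exists>i. z (i + n) = a" for n a
  proof -
    obtain i where "z (i + Suc n) = a"
      using assms[unfolded all_pairs_def, rule_format, of "Suc n" a a] by auto
    then show ?thesis by (intro exI[of _ "Suc i"]) simp
  qed
  have 2: "range (\<lambda>i. sgnb (z (i + n)) - 0) = {-1, 1}"
  proof -
    obtain i j where "z (i + n)" "\<not> z (j + n)" using b[of n True] b[of n False] by auto
    then have "1 = sgnb (z (i + n)) - 0" "-1 = sgnb (z (j + n)) - 0" by simp_all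
    then have "{-1, 1} \<subseteq> range (\<lambda>i. sgnb (z (i + n)) - 0)" by blast
    moreover have "range (\<lambda>i. sgnb (z (i + n)) - 0) \<subseteq> {-1, 1}" by (auto simp: sgnb_def)
    ultimately show ?thesis by blast
  qed
  have 3: "range (\<lambda>i. 0 - sgnb (z i)) \<subseteq> {-1, 1}" by (auto simp: sgnb_def)
  show "balances (tm_fun z) (Suc (2 * n)) = {-1, 1}"
    unfolding balances_def
    by (subst range_even_odd) (use 3 in \<open>simp only: double_sums walk_tm_fun 2, blast\<close>)
qed

text \<open>Offsets of each parity yield four triples, and two triples are common to both.\<close>

lemma card_bordered_tm_fun:
  assumes "all_pairs z" "m \<ge> 2"
  shows "card (bordered (tm_fun z) m) = 6"
proof (cases "even m")
  case True
  then obtain n where n: "m = 2 * n" by (rule evenE)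
  have n1: "n \<ge> 1" using assms(2) n by simp
  show ?thesis
    unfolding bordered_def n
    by (subst range_even_odd)
      (simp only: double_sums walk_tm_fun tm_fun_simps
         range_all_pairs[OF assms(1) n1, of "\<lambda>a b. (a, 0 - sgnb a, b)"]
         range_all_pairs[OF assms(1) n1, of "\<lambda>a b. (\<not> a, sgnb b - 0, \<not> b)"], simp add: card_insert_if)
next
  case False
  then obtain n where n: "m = Suc (2 * n)" by (metis oddE Suc_eq_plus1)
  have n1: "n \<ge> 1" "Suc n \<ge> 1" using assms(2) n by simp_all
  show ?thesis
    unfolding bordered_def n
    by (subst range_even_odd)
      (simp only: double_sums walk_tm_fun tm_fun_simps
         range_all_pairs[OF assms(1) n1(1), of "\<lambda>a b. (a, sgnb b - sgnb a, \<not> b)"]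
         range_all_pairs[OF assms(1) n1(2), of "\<lambda>a b. (\<not> a, 0 - 0, b)"], simp add: card_insert_if)
qed

text \<open>The sum 8 is the order-two count of the Thue--Morse word at odd lengths from 5
  on.\<close>

lemma card_right_left_bordered_tm_fun:
  assumes "all_pairs z" "m \<ge> 2"
  shows "card (right_bordered (tm_fun z) m) = 4" "card (left_bordered (tm_fun z) m) = 4"
proof -
  have "card (right_bordered (tm_fun z) m) = 4 \<and> card (left_bordered (tm_fun z) m) = 4"
  proof (cases "even m")
    case True
    then obtain n where n: "m = 2 * n" by (rule evenE)
    have n1: "n \<ge> 1" using assms(2) n by simp
    have "card (right_bordered (tm_fun z) m) = 4"
      unfolding right_bordered_def n
      by (subst range_even_odd)
        (simp only: double_sums walk_tm_fun tm_fun_simps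
         range_all_pairs[OF assms(1) n1, of "\<lambda>a b. (0 - 0, b)"]
         range_all_pairs[OF assms(1) n1, of "\<lambda>a b. (sgnb b - sgnb a, \<not> b)"], simp add: card_insert_if)
    moreover have "card (left_bordered (tm_fun z) m) = 4"
      unfolding left_bordered_def n
      by (subst range_even_odd)
        (simp only: double_sums walk_tm_fun tm_fun_simps
         range_all_pairs[OF assms(1) n1, of "\<lambda>a b. (a, sgnb b - sgnb a)"]
         range_all_pairs[OF assms(1) n1, of "\<lambda>a b. (\<not> a, 0 - 0)"], simp add: card_insert_if)
    ultimately show ?thesis ..
  next
    case False
    then obtain n where n: "m = Suc (2 * n)" by (metis oddE Suc_eq_plus1)
    have n1: "n \<ge> 1" "Suc n \<ge> 1" using assms(2) n by simp_all
    have "card (right_bordered (tm_fun z) m) = 4"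
      unfolding right_bordered_def n
      by (subst range_even_odd)
        (simp only: double_sums walk_tm_fun tm_fun_simps
         range_all_pairs[OF assms(1) n1(1), of "\<lambda>a b. (sgnb b - 0, \<not> b)"]
         range_all_pairs[OF assms(1) n1(2), of "\<lambda>a b. (0 - sgnb a, b)"], simp add: card_insert_if)
    moreover have "card (left_bordered (tm_fun z) m) = 4"
      unfolding left_bordered_def n
      by (subst range_even_odd)
        (simp only: double_sums walk_tm_fun tm_fun_simps
         range_all_pairs[OF assms(1) n1(2), of "\<lambda>a b. (a, 0 - sgnb a)"]
         range_all_pairs[OF assms(1) n1(2), of "\<lambda>a b. (\<not> a, sgnb b - 0)",
           unfolded add_Suc_shift[symmetric]], simp add: card_insert_if)
    ultimately show ?thesis ..
  qed
  then show "card (right_bordered (tm_fun z) m) = 4" "card (left_bordered (tm_fun z) m) = 4" by auto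
qed

lemma tm_fixpoint_all_pairs:
  assumes fixpt: "tm_fun t = t" and "\<not> t 0"
  shows "all_pairs t"
proof -
  have even: "t (2 * i) = t i" and odd: "t (Suc (2 * i)) = (\<not> t i)" for i
    using tm_fun_simps[of t i] unfolding fixpt by auto
  \<comment> \<open>The second half of the prefix of length 2^(j+1) is the complement of the
    first.\<close>
  have compl: "t (i + 2 ^ j) = (\<not> t i)" if "i < 2 ^ j" for i j
    using that
  proof (induction j arbitrary: i)
    case 0
    then show ?case using odd[of 0] by simp
  next
    case (Suc j)
    obtain h where h: "i = 2 * h \<or> i = Suc (2 * h)" by (metis evenE oddE Suc_eq_plus1)
    then have "h < 2 ^ j" using Suc.prems by auto
    then have IH: "t (h + 2 ^ j) = (\<not> t h)" by (rule Suc.IH)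
    have "2 * h + 2 ^ Suc j = 2 * (h + 2 ^ j)" "Suc (2 * h) + 2 ^ Suc j = Suc (2 * (h + 2 ^ j))"
      by simp_all
    then show ?case using h IH even odd by metis
  qed
  have both: "\<exists>i. (t i = t (i + n)) = c" if "n \<ge> 1" for n c
    using that
  proof (induction n arbitrary: c rule: less_induct)
    case (less n)
    obtain h where "n = 2 * h \<or> n = Suc (2 * h)" by (metis evenE oddE Suc_eq_plus1)
    then show ?case
    proof
      assume n: "n = 2 * h"
      then obtain i where "(t i = t (i + h)) = c" using less.IH[of h c] less.prems by auto
      then have "(t (2 * i) = t (2 * i + n)) = c" unfolding n double_sums even .
      then show ?thesis ..
    next
      assume n: "n = Suc (2 * h)"
      show ?thesis
      proof (rule ccontr)
        assume "\<not> ?thesis"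
        then have no: "(t i = t (i + n)) \<noteq> c" for i by blast
        \<comment> \<open>Failure at both offsets \<open>2 * i\<close> and
          \<open>Suc (2 * i)\<close> equates neighbouring letters, which is impossible inside the
          block at \<open>2 * h\<close>.\<close>
        have "t (i + h) = t (i + Suc h)" for i
          using no[of "2 * i"] no[of "Suc (2 * i)"] unfolding n double_sums even odd by auto
        from this[of h] this[of "Suc h"] have "t (2 * h) = t (Suc (2 * h))"
          by (simp flip: mult_2)
        then show False by (simp add: even odd)
      qed
    qed
  qed
  show ?thesis unfolding all_pairs_def
  proof (intro allI impI)
    fix n :: nat and a b :: bool assume "n \<ge> 1"
    then obtain i where i: "(t i = t (i + n)) = (a = b)" using both by blast
    show "\<exists>i. t i = a \<and> t (i + n) = b"
    proof (cases "t i = a")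
      case True
      then show ?thesis using i by auto
    next
      case False
      \<comment> \<open>Translation by a power of two beyond both positions complements both letters
        and keeps their relation.\<close>
      have "i + n < 2 ^ (i + n)" by (rule less_exp)
      moreover from this have "i < 2 ^ (i + n)" by linarith
      ultimately have "t (i + 2 ^ (i + n)) = (\<not> t i)" "t (i + n + 2 ^ (i + n)) = (\<not> t (i + n))"
        using compl[of i "i + n"] compl[of "i + n" "i + n"] by simp_all
      then show ?thesis using i False
        by (intro exI[of _ "i + 2 ^ (i + n)"]) (auto simp: ac_simps)
    qed
  qed
qed

section \<open>Order-two classes at odd lengths\<close>

lemma mom_2: "mom 2 w = [balance w, coeff (word_poly w) (Suc 0)]"
  by (simp add: mom_def coeff_0_word_poly numeral_2_eq_2)

text \<open>The constant coefficient gives the letter of the half block, the linear one the balance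
  of the word whose image remains.\<close>

lemma classes_2_tm_fun_odd:
  "classes 2 (tm_fun s) (Suc (2 * n)) =
     (\<lambda>(v, b). [sgnb b, 2 * int n * sgnb b - v]) ` right_bordered s n \<union>
     (\<lambda>(a, v). [- sgnb a, - v]) ` left_bordered s n"
proof -
  have even: "mom 2 (fac (tm_fun s) (2 * i) (Suc (2 * n)))
      = [sgnb (s (i + n)), 2 * int n * sgnb (s (i + n)) - (walk s (i + n) - walk s i)]" for i
    unfolding fac_tm_fun_even_odd mom_2 coeff_1_word_poly_snoc coeff_1_word_poly_tm_morph balance_fac
    by simp
  have odd: "mom 2 (fac (tm_fun s) (Suc (2 * i)) (Suc (2 * n)))
      = [- sgnb (s i), - (walk s (Suc i + n) - walk s (Suc i))]" for i
    unfolding fac_tm_fun_odd_odd mom_2 coeff_1_word_poly_Cons coeff_1_word_poly_tm_morph balance_fac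
    by simp
  show ?thesis
    unfolding classes_def right_bordered_def left_bordered_def
    by (subst range_even_odd) (simp only: even odd image_image prod.case)
qed

text \<open>A class shared by both parities would make two balances differ by \<open>2 * n\<close>,
  hence produce opposite powers of length \<open>n + 1\<close>.\<close>

lemma card_classes_2_tm_fun_odd:
  assumes "\<And>i i'. \<not> ((\<forall>p\<le>n. s (i + p)) \<and> (\<forall>p\<le>n. \<not> s (i' + p)))"
  shows "card (classes 2 (tm_fun s) (Suc (2 * n))) = card (right_bordered s n) + card (left_bordered s n)"
proof -
  let ?f = "\<lambda>(v, b). [sgnb b, 2 * int n * sgnb b - v]" and ?g = "\<lambda>(a, v). [- sgnb a, - v]"
  have "?f ` right_bordered s n \<inter> ?g ` left_bordered s n = {}"
  proof (intro equals0I)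
    fix y assume "y \<in> ?f ` right_bordered s n \<inter> ?g ` left_bordered s n"
    then obtain i i' where y: "y = ?f (balance (fac s i n), s (i + n))" "y = ?g (s i', balance (fac s (Suc i') n))"
      unfolding right_bordered_def left_bordered_def balance_fac by blast
    define b where "b = s (i + n)"
    have b': "s i' = (\<not> b)" using y by (auto simp: b_def sgnb_def split: if_splits)
    have eq: "2 * int n * sgnb b - balance (fac s i n) = - balance (fac s (Suc i') n)"
      using y by (simp add: b_def)
    have "balance (fac s i n) = sgnb b * int n" "balance (fac s (Suc i') n) = sgnb (\<not> b) * int n"
      using eq balance_le[of b "fac s i n"] balance_le[of "\<not> b" "fac s (Suc i') n"] by (cases b; simp)+
    then have "fac s i n = replicate n b" "fac s (Suc i') n = replicate n (\<not> b)"
      using balance_extremal[of "fac s i n" b] balance_extremal[of "fac s (Suc i') n" "\<not> b"] by simp_all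
    then have "fac s i (Suc n) = replicate (Suc n) b" "fac s i' (Suc n) = replicate (Suc n) (\<not> b)"
      unfolding fac_Suc_snoc[of s i n] fac_Suc[of s i' n] using b' by (simp_all add: b_def replicate_append_same)
    then have "\<forall>p\<le>n. s (i + p) = b" "\<forall>p\<le>n. s (i' + p) = (\<not> b)"
      unfolding fac_eq_replicate_iff less_Suc_eq_le by auto
    then show False using assms[of i i'] assms[of i' i] by (cases b) auto
  qed
  moreover have "card (?f ` right_bordered s n) = card (right_bordered s n)"
    by (rule card_image) (auto simp: inj_on_def sgnb_def split: if_splits)
  moreover have "card (?g ` left_bordered s n) = card (left_bordered s n)"
    by (rule card_image) (auto simp: inj_on_def sgnb_def split: if_splits)
  ultimately show ?thesis
    unfolding classes_2_tm_fun_odd by (subst card_Un_disjoint) simp_all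
qed

section \<open>Balances and borders at length two\<close>

lemma balances_2_subset: "balances s 2 \<subseteq> {-2, 0, 2}"
proof
  fix v assume "v \<in> balances s 2"
  then obtain i where "v = walk s (i + 2) - walk s i" by (auto simp: balances_def)
  then have "v = sgnb (s i) + sgnb (s (Suc i))" by (simp add: numeral_2_eq_2)
  then show "v \<in> {-2, 0, 2}" by (auto simp: sgnb_def)
qed

lemma in_balances_2: "sgnb (s i) + sgnb (s (Suc i)) \<in> balances s 2"
proof -
  have "sgnb (s i) + sgnb (s (Suc i)) = walk s (i + 2) - walk s i" by (simp add: numeral_2_eq_2)
  then show ?thesis unfolding balances_def by blast
qed

lemma bordered_2_eq: "bordered s 2 = range (\<lambda>i. (s i, sgnb (s (Suc i)), s (Suc (Suc i))))"
  by (simp add: bordered_def numeral_2_eq_2)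

lemma balances_2_eqI:
  assumes "recur s" "-2 \<in> balances s 2" "2 \<in> balances s 2"
  shows "balances s 2 = {-2, 0, 2}"
  using up_step(1)[OF assms] balances_2_subset[of s] assms by auto

text \<open>At this length the triples encode factors of length three, and five binary words of
  length three avoid \<open>c\<close> twice in a row.\<close>

lemma card_bordered_2_le:
  assumes "sgnb c + sgnb c \<notin> balances s 2"
  shows "card (bordered s 2) \<le> 5"
proof -
  have "bordered s 2 \<subseteq> {(\<not> c, sgnb (\<not> c), \<not> c), (\<not> c, sgnb (\<not> c), c), (c, sgnb (\<not> c), \<not> c),
     (c, sgnb (\<not> c), c), (\<not> c, sgnb c, \<not> c)}"
  proof
    fix y assume "y \<in> bordered s 2"
    then obtain i where y: "y = (s i, sgnb (s (Suc i)), s (Suc (Suc i)))" unfolding bordered_2_eq by blast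
    have "\<not> (s i = c \<and> s (Suc i) = c)" for i
    proof
      assume "s i = c \<and> s (Suc i) = c"
      then show False using in_balances_2[of s i] assms by (simp only:)
    qed
    from this[of i] this[of "Suc i"] show "y \<in> {(\<not> c, sgnb (\<not> c), \<not> c), (\<not> c, sgnb (\<not> c), c), (c, sgnb (\<not> c), \<not> c),
     (c, sgnb (\<not> c), c), (\<not> c, sgnb c, \<not> c)}"
      unfolding y by (cases c; cases "s i"; cases "s (Suc i)"; cases "s (Suc (Suc i))") simp_all
  qed
  then have "card (bordered s 2) \<le> card {(\<not> c, sgnb (\<not> c), \<not> c), (\<not> c, sgnb (\<not> c), c), (c, sgnb (\<not> c), \<not> c),
     (c, sgnb (\<not> c), c), (\<not> c, sgnb c, \<not> c)}"
    by (intro card_mono) auto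
  also have "\<dots> \<le> 5" by (cases c) (simp_all add: card_insert_if)
  finally show ?thesis .
qed

lemma not_aligned_2_balances:
  assumes "recur s" "\<not> aligned s 2"
  shows "balances s 2 = {-2, 0, 2}"
proof -
  obtain c i i' where c: "\<forall>p<2. s (i + p) = c" "\<forall>p\<le>2. s (i' + p) = (\<not> c)"
    using assms(2) unfolding aligned_def by blast
  have "s i = c" "s (Suc i) = c" "s i' = (\<not> c)" "s (Suc i') = (\<not> c)"
    using c(1)[rule_format, of 0] c(1)[rule_format, of 1] c(2)[rule_format, of 0] c(2)[rule_format, of 1]
    by simp_all
  then have "sgnb c + sgnb c \<in> balances s 2" "sgnb (\<not> c) + sgnb (\<not> c) \<in> balances s 2"
    using in_balances_2[of s i] in_balances_2[of s i'] by simp_all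
  then have "-2 \<in> balances s 2" "2 \<in> balances s 2" by (cases c; simp)+
  then show ?thesis using balances_2_eqI assms(1) by blast
qed

text \<open>If 00 or 11 were missing, at most 5 bordered triples and 3 balances would keep the total
  too small. Without alignment both occur anyway.\<close>

lemma balances_2_full:
  assumes "recur s" "M \<ge> 1" "aligned s 2 \<Longrightarrow> card (balances s 2) + M * card (bordered s 2) = 3 + M * 6"
  shows "balances s 2 = {-2, 0, 2}"
proof (cases "aligned s 2")
  case True
  have "card (balances s 2) \<le> card {-2, 0, 2 :: int}"
    by (rule card_mono) (use balances_2_subset in auto)
  then have le: "card (balances s 2) \<le> 3" by simp
  have "sgnb c + sgnb c \<in> balances s 2" for c
  proof (rule ccontr)
    assume "sgnb c + sgnb c \<notin> balances s 2"
    then have "card (bordered s 2) \<le> 5" by (rule card_bordered_2_le)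
    then have "M * card (bordered s 2) \<le> M * 5" by simp
    then show False using assms(2,3) True le by linarith
  qed
  from this[of True] this[of False] show ?thesis using balances_2_eqI[OF assms(1)] by simp
qed (rule not_aligned_2_balances[OF assms(1)])

lemma aligned_of_aligned_2:
  assumes "aligned s 2" "m \<ge> 2"
  shows "aligned s m"
  unfolding aligned_def
proof (intro allI notI)
  fix c i i' assume c: "(\<forall>p<m. s (i + p) = c) \<and> (\<forall>p\<le>m. s (i' + p) = (\<not> c))"
  then have "\<forall>p<2. s (i + p) = c" "\<forall>p\<le>2. s (i' + p) = (\<not> c)" using assms(2) by auto
  then show False using assms(1) unfolding aligned_def by blast
qed

subsection \<open>Short factors\<close>

lemma balances_1_subset: "balances s (Suc 0) \<subseteq> {-1, 1}"
  by (auto simp: balances_def sgnb_def)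

lemma balances_1_of_2:
  assumes "balances s 2 = {-2, 0, 2}"
  shows "balances s (Suc 0) = {-1, 1}"
proof -
  have two: "balances s 2 \<subseteq> (\<lambda>v. v - 1) ` balances s (Suc 0) \<union> (\<lambda>v. v + 1) ` balances s (Suc 0)"
    using balances_Suc_subset[of s "Suc 0"] by (simp add: numeral_2_eq_2)
  have ends: "2 \<in> balances s 2" "-2 \<in> balances s 2" using assms by auto
  have neighbour: "w + 1 \<in> balances s (Suc 0) \<or> w - 1 \<in> balances s (Suc 0)" if "w \<in> balances s 2" for w
    using subsetD[OF two that] by auto
  have "2 + 1 \<in> balances s (Suc 0) \<or> 2 - 1 \<in> balances s (Suc 0)"
    "-2 + 1 \<in> balances s (Suc 0) \<or> -2 - 1 \<in> balances s (Suc 0)"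
    using neighbour[OF ends(1)] neighbour[OF ends(2)] .
  with balances_1_subset[of s] have "1 \<in> balances s (Suc 0)" "-1 \<in> balances s (Suc 0)" by auto
  then show ?thesis using balances_1_subset[of s] by auto
qed

lemma balances_of_card:
  assumes "recur s" "\<And>m. m \<ge> 1 \<Longrightarrow> card (balances s m) = (if even m then 3 else 2)"
  shows "balances s (Suc (2 * n)) = {-1, 1} \<and> balances s (2 * Suc n) = {-2, 0, 2}"
proof (induction n)
  case 0
  have 1: "balances s (Suc 0) = {-1, 1}"
    using balances_1_subset[of s] assms(2)[of 1] by (intro card_subset_eq) auto
  then show ?case using balances_odd_step_card[OF 1] assms(2)[of 2] by (simp add: numeral_2_eq_2)
next
  case (Suc n)
  then have 1: "balances s (Suc (2 * Suc n)) = {-1, 1}"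
    using balances_even_step_card[OF assms(1), of "2 * Suc n"] assms(2)[of "Suc (2 * Suc n)"] by simp
  then show ?case
    using balances_odd_step_card[OF 1] assms(2)[of "Suc (Suc (2 * Suc n))"] by simp
qed

lemma balances_of_bordered:
  assumes "recur s" "balances s 2 = {-2, 0, 2}"
    and "\<And>m. m \<ge> 2 \<Longrightarrow> card (right_bordered s m) + card (left_bordered s m) = 8"
  shows "balances s (Suc (2 * n)) = {-1, 1} \<and> balances s (2 * Suc n) = {-2, 0, 2}"
proof (induction n)
  case 0
  then show ?case using balances_1_of_2[OF assms(2)] assms(2) by simp
next
  case (Suc n)
  then have 1: "balances s (Suc (2 * Suc n)) = {-1, 1}"
    using balances_even_step_bordered[OF assms(1), of "2 * Suc n"] assms(3)[of "2 * Suc n"] by simp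
  then show ?case
    using balances_odd_step_bordered[OF 1] assms(3)[of "Suc (2 * Suc n)"] by simp
qed

definition triples :: "(nat \<Rightarrow> bool) \<Rightarrow> (bool \<times> bool \<times> bool) set" where
  "triples s = range (\<lambda>i. (s i, s (Suc i), s (Suc (Suc i))))"

definition mixed_triples :: "(bool \<times> bool \<times> bool) set" where
  "mixed_triples = {(False, False, True), (False, True, False), (False, True, True),
     (True, False, False), (True, False, True), (True, True, False)}"

lemma mixed_triples_iff: "(a, m, b) \<in> mixed_triples \<longleftrightarrow> \<not> (a = m \<and> m = b)"
  by (cases a; cases b; cases m) (auto simp: mixed_triples_def)

text \<open>Explicit values for the image, since \<open>s\<close> itself may fail to be aligned at
  length two.\<close>

lemma classes_2_tm_fun_4:
  "classes 2 (tm_fun s) 4 = (\<lambda>v. [0, - v]) ` balances s 2 \<union>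
     (\<lambda>(a, m, b). [sgnb b - sgnb a, 3 * sgnb b - sgnb m]) ` triples s"
proof -
  have even: "mom 2 (tm_morph (fac s i 2)) = [0, - (walk s (i + 2) - walk s i)]" for i
    by (simp add: mom_2 coeff_1_word_poly_tm_morph balance_fac)
  have odd: "mom 2 ((\<not> s i) # tm_morph (fac s (Suc i) (2 - 1)) @ [s (i + 2)])
     = [sgnb (s (Suc (Suc i))) - sgnb (s i), 3 * sgnb (s (Suc (Suc i))) - sgnb (s (Suc i))]" for i
    unfolding mom_2 by (simp add: fac_Suc coeff_pCons numeral_2_eq_2)
  show ?thesis
    using classes_tm_fun[of 2 2 s]
    unfolding even odd balances_def triples_def by (simp add: image_image)
qed

lemma bordered_classes_2_tm_fun_4:
  "bordered_classes 2 (tm_fun s) 4 =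
     (\<lambda>(a, m, b). (a, [- sgnb a, - sgnb m], b)) ` triples s \<union>
     (\<lambda>(a, m, b). (\<not> a, [sgnb b, 2 * sgnb b - sgnb m], \<not> b)) ` triples s"
proof -
  have even: "mom 2 ((\<not> s i) # tm_morph (fac s (Suc i) (2 - 1))) = [- sgnb (s i), - sgnb (s (Suc i))]" for i
    by (simp add: mom_2 fac_Suc coeff_pCons)
  have odd: "mom 2 (tm_morph (fac s (Suc i) (2 - 1)) @ [s (i + 2)])
     = [sgnb (s (Suc (Suc i))), 2 * sgnb (s (Suc (Suc i))) - sgnb (s (Suc i))]" for i
    unfolding mom_2 by (simp add: fac_Suc coeff_pCons numeral_2_eq_2)
  show ?thesis
    using bordered_classes_tm_fun[of 2 2 s]
    unfolding even odd triples_def by (simp add: image_image)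
qed

text \<open>If a cube \<open>ccc\<close> occurs, then the total below is too large if all other words of length three occur,
  and too small otherwise.\<close>

lemma cube_count:
  assumes "balances s 2 = {-2, 0, 2}" "(c, c, c) \<in> triples s" "M \<ge> 1"
  shows "card (classes 2 (tm_fun s) 4) + M * card (bordered_classes 2 (tm_fun s) 4) \<noteq> 9 + M * 12"
proof -
  let ?g = "\<lambda>(a, m, b). [sgnb b - sgnb a, 3 * sgnb b - sgnb m]"
  let ?h = "\<lambda>(a, m, b). (a, [- sgnb a, - sgnb m], b)"
  let ?h' = "\<lambda>(a, m, b). (\<not> a, [sgnb b, 2 * sgnb b - sgnb m], \<not> b)"
  let ?A = "{[0, 2], [0, 0], [0, -2 :: int]}"
  have A: "(\<lambda>v. [0, - v]) ` balances s 2 = ?A" by (simp add: assms(1))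
  define Q where "Q = triples s \<inter> mixed_triples"
  have finQ: "finite Q" by (simp add: Q_def mixed_triples_def)
  show ?thesis
  proof (cases "Q = mixed_triples")
    case True
    then have sub: "mixed_triples \<subseteq> triples s" by (auto simp: Q_def)
    have "card (?A \<union> ?g ` mixed_triples) \<le> card (classes 2 (tm_fun s) 4)"
      by (rule card_mono[OF finite_classes]) (unfold classes_2_tm_fun_4 A, intro Un_mono image_mono sub subset_refl)
    moreover have "card (?A \<union> ?g ` mixed_triples) = 9" by (simp add: mixed_triples_def card_insert_if)
    moreover have "card (?h ` insert (c, c, c) mixed_triples \<union> ?h' ` mixed_triples)
       \<le> card (bordered_classes 2 (tm_fun s) 4)"
      by (rule card_mono[OF finite_bordered_classes])
        (unfold bordered_classes_2_tm_fun_4, intro Un_mono image_mono sub insert_subsetI assms(2))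
    \<comment> \<open>The twelve values from mixed triples are distinct, and the cube adds a
      thirteenth.\<close>
    moreover have "card (?h ` insert (c, c, c) mixed_triples \<union> ?h' ` mixed_triples) = 13"
      by (cases c) (simp_all add: mixed_triples_def card_insert_if)
    ultimately have "9 \<le> card (classes 2 (tm_fun s) 4)" "13 \<le> card (bordered_classes 2 (tm_fun s) 4)"
      by simp_all
    then have "9 + M * 13 \<le> card (classes 2 (tm_fun s) 4) + M * card (bordered_classes 2 (tm_fun s) 4)"
      by (intro add_mono mult_le_mono) auto
    then show ?thesis using assms(3) by linarith
  next
    case False
    have "card Q < card mixed_triples"
      by (rule psubset_card_mono) (use False in \<open>auto simp: Q_def mixed_triples_def\<close>)
    then have Q5: "card Q \<le> 5" by (simp add: mixed_triples_def)
    \<comment> \<open>Cubes add no class: their values already lie in \<open>?A\<close>.\<close>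
    have g: "?g t \<in> ?A \<union> ?g ` Q" if "t \<in> triples s" for t
    proof (cases "t \<in> mixed_triples")
      case True
      then have "t \<in> Q" using that by (simp add: Q_def)
      then show ?thesis by (intro UnI2 imageI)
    next
      case False
      then obtain a where "t = (a, a, a)" by (cases t) (simp add: mixed_triples_iff)
      then show ?thesis by (cases a) simp_all
    qed
    have "classes 2 (tm_fun s) 4 \<subseteq> ?A \<union> ?g ` Q"
      unfolding classes_2_tm_fun_4 A by (intro Un_least Un_upper1 image_subsetI g)
    then have "card (classes 2 (tm_fun s) 4) \<le> card (?A \<union> ?g ` Q)"
      by (rule card_mono[rotated]) (simp add: finQ)
    also have "\<dots> \<le> card ?A + card (?g ` Q)" by (rule card_Un_le)
    also have "\<dots> \<le> 3 + 5" using card_image_le[OF finQ, of ?g] Q5 by (intro add_mono) auto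
    finally have N: "card (classes 2 (tm_fun s) 4) \<le> 8" by simp
    \<comment> \<open>The only values that \<open>?h\<close> and \<open>?h'\<close> take on
      cubes.\<close>
    let ?C = "{(False, [1, 1], False), (True, [-1, -1 :: int], True)}"
    have h: "?h t \<in> ?h ` Q \<union> ?h' ` Q \<union> ?C" "?h' t \<in> ?h ` Q \<union> ?h' ` Q \<union> ?C"
      if "t \<in> triples s" for t
    proof -
      have "?h t \<in> ?h ` Q \<union> ?h' ` Q \<union> ?C \<and> ?h' t \<in> ?h ` Q \<union> ?h' ` Q \<union> ?C"
      proof (cases "t \<in> mixed_triples")
        case True
        then have "t \<in> Q" using that by (simp add: Q_def)
        then have "?h t \<in> ?h ` Q" "?h' t \<in> ?h' ` Q" by (rule imageI)+
        then show ?thesis by (simp only: Un_iff simp_thms)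
      next
        case False
        then obtain a where "t = (a, a, a)" by (cases t) (simp add: mixed_triples_iff)
        then show ?thesis by (cases a) simp_all
      qed
      then show "?h t \<in> ?h ` Q \<union> ?h' ` Q \<union> ?C" "?h' t \<in> ?h ` Q \<union> ?h' ` Q \<union> ?C" by (rule conjunct1, rule conjunct2)
    qed
    have "bordered_classes 2 (tm_fun s) 4 \<subseteq> ?h ` Q \<union> ?h' ` Q \<union> ?C"
      unfolding bordered_classes_2_tm_fun_4 by (intro Un_least image_subsetI h)
    then have "card (bordered_classes 2 (tm_fun s) 4) \<le> card (?h ` Q \<union> ?h' ` Q \<union> ?C)"
      by (rule card_mono[rotated]) (simp add: finQ)
    also have "\<dots> \<le> card (?h ` Q) + card (?h' ` Q) + card ?C"
      by (rule order_trans[OF card_Un_le add_right_mono[OF card_Un_le]])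
    also have "\<dots> \<le> 5 + 5 + 2"
      using card_image_le[OF finQ, of ?h] card_image_le[OF finQ, of ?h'] Q5 by (intro add_mono) auto
    finally have "card (bordered_classes 2 (tm_fun s) 4) \<le> 12" by simp
    then have "M * card (bordered_classes 2 (tm_fun s) 4) \<le> M * 12" by simp
    then show ?thesis using N by linarith
  qed
qed

text \<open>Opposite cubes together with the up and down moves realise all six pairs on each side,
  which give ten classes instead of eight.\<close>

lemma no_two_cubes:
  assumes "recur s" "balances s 2 = {-2, 0, 2}" "card (classes 2 (tm_fun s) 5) = 8"
  shows "\<not> ((\<forall>p\<le>2. s (i + p)) \<and> (\<forall>p\<le>2. \<not> s (i' + p)))"
proof
  assume cubes: "(\<forall>p\<le>2. s (i + p)) \<and> (\<forall>p\<le>2. \<not> s (i' + p))"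
  have i: "s i" "s (Suc i)" "s (Suc (Suc i))" "\<not> s i'" "\<not> s (Suc i')" "\<not> s (Suc (Suc i'))"
    using cubes[THEN conjunct1, rule_format, of 0] cubes[THEN conjunct1, rule_format, of 1]
      cubes[THEN conjunct1, rule_format, of 2] cubes[THEN conjunct2, rule_format, of 0]
      cubes[THEN conjunct2, rule_format, of 1] cubes[THEN conjunct2, rule_format, of 2] by simp_all
  have in_bal: "-2 \<in> balances s 2" "0 \<in> balances s 2" "2 \<in> balances s 2" using assms(2) by auto
  have "(2, True) \<in> right_bordered s 2" "(True, 2) \<in> left_bordered s 2"
    unfolding right_bordered_def left_bordered_def
    by (rule range_eqI[of _ _ i], simp add: numeral_2_eq_2 i)+
  moreover have "(-2, False) \<in> right_bordered s 2" "(False, -2) \<in> left_bordered s 2"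
    unfolding right_bordered_def left_bordered_def
    by (rule range_eqI[of _ _ i'], simp add: numeral_2_eq_2 i)+
  ultimately have R: "{(-2, True), (0, True), (2, True), (-2, False), (0, False), (2, False)} \<subseteq> right_bordered s 2"
    and L: "{(True, -2), (True, 0), (True, 2), (False, -2), (False, 0), (False, 2)} \<subseteq> left_bordered s 2"
    using up_step(2,3)[OF assms(1) in_bal(1,2)] up_step(2,3)[OF assms(1) in_bal(2,3)]
      down_step(2,3)[OF assms(1) in_bal(1,2)] down_step(2,3)[OF assms(1) in_bal(2,3)] by simp_all
  let ?f = "\<lambda>(v, b). [sgnb b, 2 * int 2 * sgnb b - v]" and ?g = "\<lambda>(a, v). [- sgnb a, - v]"
  have five: "(5 :: nat) = Suc (2 * 2)" by simp
  have "?f ` {(-2, True), (0, True), (2, True), (-2, False), (0, False), (2, False)} \<union>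
    ?g ` {(True, -2), (True, 0), (True, 2), (False, -2), (False, 0), (False, 2)} \<subseteq> classes 2 (tm_fun s) 5"
    (is "?X \<subseteq> _")
    unfolding five classes_2_tm_fun_odd by (intro Un_mono image_mono R L)
  then have "card ?X \<le> 8" using card_mono[of "classes 2 (tm_fun s) 5" ?X] assms(3) by simp
  moreover have "card ?X = 10" by (simp add: card_insert_if)
  ultimately show False by simp
qed

subsection \<open>Desubstitution\<close>

text \<open>One level of desubstitution: the counts of order \<open>K + 1\<close> make the balances
  of the seed \<open>s\<close> those of the Thue--Morse word.\<close>

lemma level_balances:
  assumes rec: "recur s" and fixpt: "tm_fun t = t" and t0: "\<not> t 0"
    and eq: "\<And>n. card (classes (Suc K) ((tm_fun ^^ K) s) n) = card (classes (Suc K) t n)"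
  shows "balances s (Suc (2 * n)) = {-1, 1} \<and> balances s (2 * Suc n) = {-2, 0, 2}"
proof -
  have pairs: "all_pairs t" using tm_fixpoint_all_pairs[OF fixpt t0] .
  have t_pow: "(tm_fun ^^ K) t = t" for K by (induction K) (simp_all add: fixpt)
  have t_even: "card (balances t (2 * m)) = 3" if "m \<ge> 1" for m
    using balances_tm_fun(1)[OF pairs that] by (simp add: fixpt)
  have t_odd: "card (balances t (Suc (2 * m))) = 2" for m
    using balances_tm_fun(2)[OF pairs, of m] by (simp add: fixpt)
  have t_bal: "card (balances t m) = (if even m then 3 else 2)" if "m \<ge> 1" for m
  proof (cases "even m")
    case True
    then obtain h where "m = 2 * h" by (rule evenE)
    then show ?thesis using t_even[of h] that by simp
  next
    case False
    then obtain h where "m = Suc (2 * h)" by (metis oddE Suc_eq_plus1)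
    then show ?thesis using t_odd[of h] by simp
  qed
  have t_bord: "card (bordered t m) = 6" if "m \<ge> 2" for m
    using card_bordered_tm_fun[OF pairs that] by (simp add: fixpt)
  have count_t: "card (classes (Suc K) t (2 ^ K * m)) = card (balances t m) + (2 ^ K - 1) * 6" if "m \<ge> 2" for m
    using card_classes_tm_fun_power(1)[of t m 1 K] aligned_tm_fun[OF that, of t] that
    by (simp add: t_pow fixpt card_classes_1 card_bordered_classes_1 t_bord)
  have count_s: "card (balances s m) + (2 ^ K - 1) * card (bordered s m) = card (balances t m) + (2 ^ K - 1) * 6"
    if "aligned s m" "m \<ge> 2" for m
    using card_classes_tm_fun_power(1)[of s m 1 K] that count_t[OF that(2)] eq[of "2 ^ K * m"]
    by (simp add: card_classes_1 card_bordered_classes_1)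
  consider "K = 0" | "K = 1" | K' where "K = Suc K'" "K' \<ge> 1"
    by (metis One_nat_def Suc_leI gr0I not0_implies_Suc)
  then show ?thesis
  proof cases
    case 1
    have "card (balances s m) = card (balances t m)" for m
      using eq[of m] by (simp add: 1 card_classes_1)
    then show ?thesis by (intro balances_of_card[OF rec]) (simp only: t_bal)
  next
    case 2
    \<comment> \<open>For \<open>K = 1\<close> the equation only fixes the sum of balance and border
      counts. It settles length two; odd lengths of the image do the rest.\<close>
    have bal2: "balances s 2 = {-2, 0, 2}"
      using balances_2_full[OF rec, of 1] count_s[of 2] t_even[of 1] by (simp add: 2)
    have t_no: "\<not> ((\<forall>p\<le>m. t (i + p)) \<and> (\<forall>p\<le>m. \<not> t (i' + p)))" if "m \<ge> 2" for m i i'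
    proof
      assume c: "(\<forall>p\<le>m. t (i + p)) \<and> (\<forall>p\<le>m. \<not> t (i' + p))"
      show False
        by (rule alignedD[OF aligned_tm_fun[OF that, of t], of i' True i]) (use c in \<open>simp_all add: fixpt\<close>)
    qed
    have t_count: "card (classes 2 t (Suc (2 * m))) = 8" if "m \<ge> 2" for m
      using card_classes_2_tm_fun_odd[of m t, OF t_no[OF that]]
        card_right_left_bordered_tm_fun[OF pairs that] by (simp add: fixpt)
    have count: "card (classes 2 (tm_fun s) (Suc (2 * m))) = 8" if "m \<ge> 2" for m
      using eq[of "Suc (2 * m)"] t_count[OF that] by (simp add: 2 numeral_2_eq_2)
    have "\<not> ((\<forall>p\<le>m. s (i + p)) \<and> (\<forall>p\<le>m. \<not> s (i' + p)))" if "m \<ge> 2" for m i i'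
      using no_two_cubes[OF rec bal2, of i i'] count[of 2] that by auto
    then have "card (right_bordered s m) + card (left_bordered s m) = 8" if "m \<ge> 2" for m
      using card_classes_2_tm_fun_odd[of m s] count[OF that] that by simp
    then show ?thesis by (rule balances_of_bordered[OF rec bal2])
  next
    case (3 K')
    define M :: nat where "M = 2 ^ K - 1"
    define M' :: nat where "M' = 2 ^ K' - 1"
    have "(2 :: nat) ^ 1 \<le> 2 ^ K'" using 3(2) by (intro power_increasing) auto
    then have M': "M' \<ge> 1" "M = 2 * M' + 1" by (auto simp: M_def M'_def 3(1))
    have bal2: "balances s 2 = {-2, 0, 2}"
      using balances_2_full[OF rec, of M] count_s[of 2] t_even[of 1] M' by (simp add: M_def)
    \<comment> \<open>The count starts from \<open>tm_fun s\<close>, which is aligned in any case,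
      with \<open>K'\<close> levels left; 9 + 12 M' equals the Thue--Morse total 3 + 6 M.\<close>
    have al2: "aligned s 2"
    proof (rule ccontr)
      assume "\<not> aligned s 2"
      then obtain c i i' where cube: "(\<forall>p<2. s (i + p) = c) \<and> (\<forall>p\<le>2. s (i' + p) = (\<not> c))"
        unfolding aligned_def by blast
      have "s i' = (\<not> c)" "s (Suc i') = (\<not> c)" "s (Suc (Suc i')) = (\<not> c)"
        using cube[THEN conjunct2, rule_format, of 0] cube[THEN conjunct2, rule_format, of 1]
          cube[THEN conjunct2, rule_format, of 2] by simp_all
      then have "(\<not> c, \<not> c, \<not> c) \<in> triples s"
        unfolding triples_def by (intro range_eqI[of _ _ i']) simp
      then have "card (classes 2 (tm_fun s) 4) + M' * card (bordered_classes 2 (tm_fun s) 4) \<noteq> 9 + M' * 12"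
        by (rule cube_count[OF bal2 _ M'(1)])
      moreover have "card (classes (Suc K) ((tm_fun ^^ K) s) (2 ^ K * 2))
         = card (classes 2 (tm_fun s) 4) + M' * card (bordered_classes 2 (tm_fun s) 4)"
      proof -
        have eqs: "(tm_fun ^^ K) s = (tm_fun ^^ K') (tm_fun s)" "(2 :: nat) ^ K * 2 = 2 ^ K' * 4" "Suc K = 2 + K'"
          by (simp_all only: 3(1) funpow_Suc_right o_apply) simp_all
        show ?thesis
          unfolding eqs M'_def by (rule card_classes_tm_fun_power(1)) (simp_all add: aligned_tm_fun)
      qed
      moreover have "card (classes (Suc K) ((tm_fun ^^ K) s) (2 ^ K * 2)) = 3 + M * 6"
        using eq[of "2 ^ K * 2"] count_t[of 2] t_even[of 1] by (simp add: M_def)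
      ultimately show False using M'(2) by simp
    qed
    \<comment> \<open>The bound T >= 2 (N - 1) gives N <= 3. Then N differs from the Thue--Morse
      value by at most 2, less than M, which forces T = 6.\<close>
    have cnt: "card (balances s m) = card (balances t m)" if m: "m \<ge> 2" for m
    proof -
      define N T where "N = card (balances s m)" and "T = card (bordered s m)"
      have c: "N + M * T = card (balances t m) + M * 6"
        using count_s[OF aligned_of_aligned_2[OF al2 m] m] by (simp add: N_def T_def M_def)
      have t23: "card (balances t m) = 2 \<or> card (balances t m) = 3" using t_bal[of m] m by auto
      have N1: "N \<ge> 1" unfolding N_def by (metis One_nat_def Suc_leI balances_nonempty card_gt_0_iff finite_balances)
      have T: "2 * (N - 1) \<le> T" unfolding N_def T_def by (rule card_bordered_ge[OF rec])
      have "M \<ge> 3" using M' by simp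
      have "N \<le> 3"
      proof (rule ccontr)
        assume "\<not> N \<le> 3"
        then have "T \<ge> 6" using T by simp
        then have "M * 6 \<le> M * T" by simp
        then show False using c t23 \<open>\<not> N \<le> 3\<close> by linarith
      qed
      have "T = 6"
      proof (rule ccontr)
        assume "T \<noteq> 6"
        then consider "T \<le> 5" | "T \<ge> 7" by linarith
        then show False
        proof cases
          case 1
          then have "M * T \<le> M * 5" by simp
          then show False using c t23 \<open>N \<le> 3\<close> \<open>M \<ge> 3\<close> by linarith
        next
          case 2
          then have "M * 7 \<le> M * T" by simp
          then show False using c t23 N1 \<open>M \<ge> 3\<close> by linarith
        qed
      qed
      then show ?thesis using c by (simp add: N_def)
    qed
    have "card (balances s m) = (if even m then 3 else 2)" if "m \<ge> 1" for m
    proof (cases "m = 1")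
      case True
      then show ?thesis using balances_1_of_2[OF bal2] by simp
    next
      case False
      then show ?thesis using cnt[of m] t_bal[of m] that by simp
    qed
    then show ?thesis by (rule balances_of_card[OF rec])
  qed
qed

section \<open>From streams to functions and back\<close>

lemma stake_sdrop_eq_fac: "stake n (sdrop i x) = fac (snth x) i n"
  by (auto simp: list_eq_iff_nth_eq fac_def sdrop_snth)

lemma factors_of_length: "{w \<in> factors x. length w = n} = range (\<lambda>i. fac (snth x) i n)"
  by (auto simp: factors_def occurs_at_def stake_sdrop_eq_fac intro: range_eqI[OF sym])

lemma snth_funpow_tm_smorph: "snth ((tm_smorph ^^ k) s) = (tm_fun ^^ k) (snth s)"
  by (induction k) (auto simp: fun_eq_iff snth_tm_smorph tm_fun_def)

lemma snth_thue_morse: "tm_fun (snth thue_morse) = snth thue_morse" "\<not> snth thue_morse 0"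
  using snth_funpow_tm_smorph[of 1 thue_morse] thue_morse_fixpoint by simp_all

text \<open>On factors of a \<open>K\<close>-fold image, binomial and moment equivalence of order
  \<open>K + 1\<close> coincide; \<open>x\<close> need only have the same factors of length
  \<open>n\<close>.\<close>

lemma binom_complexity_eq_card_classes:
  assumes "range (\<lambda>i. fac (snth x) i n) = range (\<lambda>i. fac ((tm_fun ^^ K) s) i n)"
  shows "binom_complexity (Suc K) x n = card (classes (Suc K) ((tm_fun ^^ K) s) n)"
proof -
  let ?R = "{(u, v). binom_equiv (Suc K) u (v :: bool list)}"
  let ?f = "fac ((tm_fun ^^ K) s)"
  have "{w \<in> factors x. length w = n} // ?R = range (\<lambda>i. ?R `` {?f i n})"
    unfolding factors_of_length assms quotient_def by blast
  moreover have "card (range (\<lambda>i. ?R `` {?f i n})) = card (range (\<lambda>i. mom (Suc K) (?f i n)))"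
  proof (rule card_range_cong)
    fix i j
    have "?R `` {?f i n} = ?R `` {?f j n} \<longleftrightarrow> binom_equiv (Suc K) (?f i n) (?f j n)"
      by (auto simp: binom_equiv_def)
    also have "\<dots> \<longleftrightarrow> moment_equiv (Suc K) (?f i n) (?f j n)"
      using binom_equiv_imp_moment_equiv[of "Suc K"] moment_equiv_imp_binom_equiv_factors by auto
    also have "\<dots> \<longleftrightarrow> mom (Suc K) (?f i n) = mom (Suc K) (?f j n)" by (simp add: mom_eq_iff)
    finally show "?R `` {?f i n} = ?R `` {?f j n} \<longleftrightarrow> mom (Suc K) (?f i n) = mom (Suc K) (?f j n)" .
  qed
  ultimately show ?thesis by (simp add: binom_complexity_def classes_def)
qed

lemma recurrent_imp_recur:
  assumes "recurrent x"
  shows "recur (snth x)"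
  unfolding recur_def
proof (intro allI)
  fix i n m
  let ?w = "fac (snth x) i n"
  have "?w \<in> factors x" unfolding factors_def occurs_at_def stake_sdrop_eq_fac by auto
  then have "infinite {i. occurs_at ?w x i}" using assms by (simp add: recurrent_def)
  then obtain i' where "i' \<ge> m" "occurs_at ?w x i'"
    unfolding infinite_nat_iff_unbounded_le by blast
  then show "\<exists>i'\<ge>m. \<forall>p<n. x !! (i' + p) = x !! (i + p)"
    by (auto simp: occurs_at_def stake_sdrop_eq_fac fac_eq_iff)
qed

lemma recur_shift:
  assumes "recur s"
  shows "recur (\<lambda>n. s (e + n))"
  unfolding recur_def
proof (intro allI)
  fix i n m
  obtain i' where i': "i' \<ge> e + m" "\<forall>p<n. s (i' + p) = s (e + i + p)"
    using assms unfolding recur_def by blast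
  have "\<forall>p<n. s (e + (i' - e + p)) = s (e + (i + p))" using i' by (simp add: add.assoc)
  then show "\<exists>i'\<ge>m. \<forall>p<n. s (e + (i' + p)) = s (e + (i + p))" using i'(1) by (intro exI[of _ "i' - e"]) simp
qed

text \<open>Dropping a prefix of a recurrent word loses no factor, so complexities of
  \<open>x\<close> can be computed on a tail.\<close>

lemma range_fac_shift:
  assumes "recur s"
  shows "range (\<lambda>i. fac s i n) = range (\<lambda>i. fac (\<lambda>n. s (e + n)) i n)"
proof -
  have shift: "fac (\<lambda>n. s (e + n)) i n = fac s (e + i) n" for i
    by (simp add: fac_eq_iff add.assoc)
  have "fac s i n \<in> range (\<lambda>i. fac s (e + i) n)" for i
  proof -
    obtain i' where "i' \<ge> e" "\<forall>p<n. s (i' + p) = s (i + p)"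
      using assms unfolding recur_def by blast
    then have "fac s i n = fac s (e + (i' - e)) n" by (simp add: fac_eq_iff)
    then show ?thesis by (rule range_eqI)
  qed
  then show ?thesis unfolding shift by auto
qed

lemma funpow_tm_fun_shift: "(tm_fun ^^ K) (\<lambda>n. s (c + n)) = (\<lambda>n. (tm_fun ^^ K) s (2 ^ K * c + n))"
proof (induction K)
  case (Suc K)
  have "tm_fun (\<lambda>n. r (d + n)) n = tm_fun r (2 * d + n)" for r d n
    by (simp add: tm_fun_def)
  then show ?case by (simp add: Suc fun_eq_iff mult.assoc)
qed simp

text \<open>The two \<open>k\<close>-fold letter images are complementary, so an image is a fixed
  periodic word with each block flipped according to its seed letter.\<close>

lemma funpow_tm_fun_split:
  "(tm_fun ^^ k) y q = (y (q div 2 ^ k) \<noteq> (tm_fun ^^ k) (\<lambda>_. False) q)"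
proof (induction k arbitrary: q)
  case (Suc k)
  show ?case using Suc[of "q div 2"] by (auto simp: tm_fun_def div_mult2_eq)
qed simp

text \<open>Induction on the level, carrying recurrence of the seed along; the step to
  \<open>Suc K\<close> uses the complexity of order \<open>Suc K\<close>.\<close>

lemma desubstitute_tail:
  assumes "recurrent x" "TM k x" "K \<le> k"
  shows "\<exists>e s. recur s \<and> (\<forall>n. x !! (e + n) = (tm_fun ^^ K) s n)"
  using assms(3)
proof (induction K)
  case 0
  then show ?case using recurrent_imp_recur[OF assms(1)] by (intro exI[of _ 0] exI[of _ "snth x"]) simp
next
  case (Suc K)
  then obtain e s where rec: "recur s" and tail: "\<And>n. x !! (e + n) = (tm_fun ^^ K) s n" by auto
  let ?t = "snth thue_morse"
  have "(tm_fun ^^ K) ?t = ?t" by (induction K) (simp_all add: snth_thue_morse)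
  then have t: "binom_complexity (Suc K) thue_morse n = card (classes (Suc K) ?t n)" for n
    using binom_complexity_eq_card_classes[of thue_morse n K ?t] by simp
  have "binom_complexity (Suc K) x n = card (classes (Suc K) ((tm_fun ^^ K) s) n)" for n
    by (rule binom_complexity_eq_card_classes)
      (use range_fac_shift[OF recurrent_imp_recur[OF assms(1)], of n e] in \<open>simp add: tail\<close>)
  moreover have "binom_complexity (Suc K) x = binom_complexity (Suc K) thue_morse"
    using assms(2) Suc.prems by (simp add: TM_def)
  ultimately have eq: "card (classes (Suc K) ((tm_fun ^^ K) s) n) = card (classes (Suc K) ?t n)" for n
    by (simp add: t)
  note bal = level_balances[OF rec snth_thue_morse eq]
  have "balances s n \<subseteq> {-1, 1}" if "odd n" for n
    using that bal by (metis oddE Suc_eq_plus1 order_refl)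
  then obtain e' z where z: "\<And>n. s (e' + n) = tm_fun z n" using tail_eq_tm_fun by blast
  have recz: "recur (tm_fun z)" using recur_shift[OF rec, of e'] by (simp add: z)
  \<comment> \<open>Balance 2 at length two yields the factor 11, the square that transfers
    recurrence to \<open>z\<close>.\<close>
  have "2 \<in> balances s 2" using bal[of 0] by simp
  then obtain i where "2 = walk s (i + 2) - walk s i" unfolding balances_def by blast
  then have "sgnb (s i) + sgnb (s (Suc i)) = 2" by (simp add: numeral_2_eq_2)
  then have i: "s i" "s (Suc i)" by (auto simp: sgnb_def split: if_splits)
  obtain i' where i': "i' \<ge> e'" "\<forall>p<2. s (i' + p) = s (i + p)" using rec unfolding recur_def by blast
  have "s i'" "s (Suc i')" using i'(2)[rule_format, of 0] i'(2)[rule_format, of 1] i by simp_all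
  then have "tm_fun z (i' - e') = tm_fun z (Suc (i' - e'))"
    using z[of "i' - e'"] z[of "Suc (i' - e')"] i'(1) by simp
  then have "recur z" by (rule recur_tm_fun_imp_recur[OF recz])
  moreover have "x !! (e + 2 ^ K * e' + n) = (tm_fun ^^ Suc K) z n" for n
  proof -
    have "x !! (e + 2 ^ K * e' + n) = (tm_fun ^^ K) (\<lambda>n. s (e' + n)) n"
      using tail[of "2 ^ K * e' + n"] by (simp add: funpow_tm_fun_shift add.assoc)
    then show ?thesis by (simp only: z funpow_Suc_right o_apply)
  qed
  ultimately show ?case by blast
qed

text \<open>Every prefix reappears inside the desubstituted tail at one of 2^k offsets within a
  block; one offset serves all prefixes, and the seed is then read off block by block.\<close>

lemma recur_tail_extends:
  assumes "recur x" "\<And>n. x (e + n) = (tm_fun ^^ k) s n"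
  shows "\<exists>r<2 ^ k. \<exists>Y. \<forall>p. x p = (tm_fun ^^ k) Y (p + r)"
proof -
  define G where "G r l \<longleftrightarrow> (\<exists>Y. \<forall>p<l. x p = (tm_fun ^^ k) Y (p + r))" for r l
  have G: "\<exists>r<2 ^ k. G r l" for l
  proof -
    obtain i where i: "i \<ge> e" "\<forall>p<l. x (i + p) = x (0 + p)"
      using assms(1) unfolding recur_def by blast
    define c r where "c = (i - e) div 2 ^ k" and "r = (i - e) mod 2 ^ k"
    have ie: "i = e + (2 ^ k * c + r)" using i(1) by (simp add: c_def r_def)
    have "x p = (tm_fun ^^ k) (\<lambda>n. s (c + n)) (p + r)" if "p < l" for p
    proof -
      have "x p = x (e + (2 ^ k * c + (p + r)))"
        using i(2)[rule_format, OF that] unfolding ie by (simp add: ac_simps)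
      then show ?thesis unfolding assms(2) funpow_tm_fun_shift .
    qed
    moreover have "r < 2 ^ k" by (simp add: r_def)
    ultimately show ?thesis unfolding G_def by blast
  qed
  \<comment> \<open>If each offset \<open>r\<close> failed at a length \<open>l r\<close>, a prefix
    as long as the sum of these lengths would admit no offset.\<close>
  have "\<exists>r<2 ^ k. \<forall>l. G r l"
  proof (rule ccontr)
    assume "\<not> ?thesis"
    then have "\<forall>r. \<exists>l. r < 2 ^ k \<longrightarrow> \<not> G r l" by blast
    then obtain l where l: "\<And>r. r < 2 ^ k \<Longrightarrow> \<not> G r (l r)" by metis
    obtain r where r: "r < 2 ^ k" "G r (\<Sum>r<2 ^ k. l r)" using G by blast
    have "l r \<le> (\<Sum>r<2 ^ k. l r)" by (rule member_le_sum) (use r in auto)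
    then have "G r (l r)" using r(2) unfolding G_def by (meson less_le_trans)
    then show False using l r(1) by blast
  qed
  then obtain r where r: "r < 2 ^ k" "\<And>l. G r l" by blast
  define \<tau> where "\<tau> = (tm_fun ^^ k) (\<lambda>_. False)"
  text \<open>For c = 0 the truncated subtraction yields position 0, which also lies in block 0.\<close>
  define Y where "Y c = (x (c * 2 ^ k - r) \<noteq> \<tau> (c * 2 ^ k - r + r))" for c
  have "x p = (tm_fun ^^ k) Y (p + r)" for p
  proof -
    define c where "c = (p + r) div 2 ^ k"
    define q where "q = c * 2 ^ k - r"
    have q: "(q + r) div 2 ^ k = c"
    proof (cases c)
      case (Suc c')
      then have "q + r = c * 2 ^ k" using r(1) by (simp add: q_def)
      then show ?thesis by simp
    qed (use r(1) in \<open>simp add: q_def\<close>)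
    \<comment> \<open>The seed may depend on the prefix, so one prefix covering both
      \<open>p\<close> and \<open>q\<close> is taken; the letter \<open>Z c\<close> then
      cancels.\<close>
    obtain Z where Z: "\<And>p'. p' < Suc (p + q) \<Longrightarrow> x p' = (tm_fun ^^ k) Z (p' + r)"
      using r(2)[of "Suc (p + q)"] unfolding G_def by blast
    have "x p = (Z c \<noteq> \<tau> (p + r))"
      using Z[of p] funpow_tm_fun_split[of k Z "p + r"] by (simp add: c_def \<tau>_def)
    moreover have "x q = (Z c \<noteq> \<tau> (q + r))"
      using Z[of q] funpow_tm_fun_split[of k Z "q + r"] by (simp add: q \<tau>_def)
    ultimately have "x p = (Y c \<noteq> \<tau> (p + r))" by (auto simp: Y_def q_def)
    then show ?thesis using funpow_tm_fun_split[of k Y "p + r"] by (simp add: c_def \<tau>_def)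
  qed
  then show ?thesis using r(1) by blast
qed

lemma tm_smorph_shift: "tm_smorph (u @- s) = tm_morph u @- tm_smorph s"
  by (induction u) (simp_all add: tm_smorph_SCons)

lemma funpow_tm_smorph_shift: "(tm_smorph ^^ k) (u @- s) = (tm_morph ^^ k) u @- (tm_smorph ^^ k) s"
  by (induction k) (simp_all add: tm_smorph_shift)

lemma length_funpow_tm_morph: "length ((tm_morph ^^ k) u) = 2 ^ k * length u"
  by (induction k) simp_all

theorem theorem5p2:
  fixes x :: "bool stream" and k :: nat
  assumes "recurrent x"
    and "k \<ge> 1"
    and "TM k x"
  shows "\<exists>y u. x = u @- (tm_smorph ^^ k) y \<and>
           (strict_suffix u ((tm_morph ^^ k) [False]) \<or> strict_suffix u ((tm_morph ^^ k) [True]))"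
proof -
  obtain e s where "\<And>n. x !! (e + n) = (tm_fun ^^ k) s n"
    using desubstitute_tail[OF assms(1,3) order_refl] by blast
  then obtain r Y where r: "r < 2 ^ k" and Y: "\<And>p. x !! p = (tm_fun ^^ k) Y (p + r)"
    using recur_tail_extends[OF recurrent_imp_recur[OF assms(1)]] by blast
  define ys where "ys = smap Y nats"
  have "snth ys = Y" by (simp add: ys_def fun_eq_iff)
  then have x: "x = sdrop r ((tm_smorph ^^ k) ys)"
    by (simp add: stream_snth_eq Y sdrop_snth snth_funpow_tm_smorph add.commute)
  show ?thesis
  proof (cases "r = 0")
    case True
    \<comment> \<open>Offset 0 is separate: a whole block would not be a proper suffix, so
      \<open>u\<close> is empty and all of \<open>ys\<close> remains.\<close>
    have "(tm_morph ^^ k) [False] \<noteq> []" using length_funpow_tm_morph[of k "[False]"] by auto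
    then have "strict_suffix [] ((tm_morph ^^ k) [False])" by (simp add: strict_suffix_def)
    then show ?thesis using x True by (intro exI[of _ ys] exI[of _ "[]"]) simp
  next
    case False
    \<comment> \<open>The first block loses its first \<open>r\<close> letters to become
      \<open>u\<close>, and the seed loses its first letter.\<close>
    define w where "w = (tm_morph ^^ k) [shd ys]"
    have "(tm_smorph ^^ k) ys = w @- (tm_smorph ^^ k) (stl ys)"
      using funpow_tm_smorph_shift[of k "[shd ys]" "stl ys"] by (simp add: w_def)
    moreover have len: "r < length w" using r by (simp add: w_def length_funpow_tm_morph)
    ultimately have "x = drop r w @- (tm_smorph ^^ k) (stl ys)" using x by (simp add: sdrop_shift)
    moreover have "strict_suffix (drop r w) w"
    proof -
      have "length (drop r w) < length w" using len False by simp
      then have "drop r w \<noteq> w" by (metis less_irrefl)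
      then show ?thesis by (simp add: strict_suffix_def suffix_drop)
    qed
    ultimately show ?thesis unfolding w_def by (cases "shd ys") auto
  qed
qed

end
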